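(* Let $N=N_1\circ N_2$ be a feedforward coalescence network with coalescence cell $c$, where $N_1,N_2$ have $n_1,n_2$ cells, and let $F^N,F^{N_1},F^{N_2}$ be the diffusive admissible systems of $N,N_1,N_2$ defined by the same smooth pair $(g,h)$, with the origin an equilibrium for every $\lambda$. (a) Suppose a bifurcation condition for $F^N$ holds which is a bifurcation condition for $F^{N_1}$ but not for $F^{N_2}$. Then each bifurcation branch of $F^{N_1}$ corresponds to a unique bifurcation branch of $F^N$, and vice versa: for each bifurcation branch $(b_1,b_c)$ of $F^{N_1}$ there is a unique $b_2$ (with values in $\mathbb{R}^{n_2-1}$) such that $(b_1,b_c,b_2)$ is a bifurcation branch of $F^N$; and for each bifurcation branch $(b_1,b_c,b_2)$ of $F^N$, the pair $(b_1,b_c)$ is a bifurcation branch of $F^{N_1}$. (b) Suppose a bifurcation condition for $F^N$ holds which is a bifurcation condition for $F^{N_2}$ but not for $F^{N_1}$. Then each bifurcation branch of $F^{N_2}$ corresponds to a unique bifurcation branch of $F^N$, and vice versa: for each bifurcation branch $(b_c,b_2)$ of $F^{N_2}$ there is a unique $b_1$ (with values in $\mathbb{R}^{n_1-1}$) such that $(b_1,b_c,b_2)$ is a bifurcation branch of $F^N$; and for each bifurcation branch $(b_1,b_c,b_2)$ of $F^N$, the pair $(b_c,b_2)$ is a bifurcation branch of $F^{N_2}$.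
   Context: A (weighted, uniform) network $N$ with $n$ cells consists of a finite set $C$ of cells and a real weighted adjacency matrix $W_N=(w_{ij})$, where $w_{ij}$ is the weight of the edge from cell $j$ to cell $i$ ($0$ if there is no edge; self-loops $w_{ii}$ are allowed). Networks are assumed connected as undirected graphs. The input valency of cell $i$ is $v(i)=\sum_j w_{ij}$, $D_N$ is the diagonal matrix of input valencies, and the Laplacian is $L_N=D_N-W_N$. Coalescence: $N=N_1\circ N_2$ has cell set $C=C_1\cup C_2$ with $C_1\cap C_2=\{c\}$, and weights $w^N_{cc}=w^{N_1}_{cc}+w^{N_2}_{cc}$; $w^N_{ab}=w^{N_i}_{ab}$ if $a,b\in C_i$ and $(a,b)\ne(c,c)$; all other weights are $0$. Cells are ordered so that $c$ is the last cell of $N_1$ and the first cell of $N_2$; states of $N$ are written $(x_1,x_c,x_2)\in\mathbb{R}^{n_1-1}\times\mathbb{R}\times\mathbb{R}^{n_2-1}$. $N$ is a feedforward coalescence network (FFCN) if, in $N_2$, the cell $c$ receives no input edge from the other cells of $N_2$ (a self-loop at $c$ is allowed). Given smooth $g:\mathbb{R}\times\mathbb{R}\to\mathbb{R}$ and $h:\mathbb{R}\times\mathbb{R}\times\mathbb{R}\to\mathbb{R}$, the admissible system $F^N:\mathbb{R}^n\times\mathbb{R}\to\mathbb{R}^n$ of a network $N$ has components $f_i(x,\lambda)=g(x_i,\lambda)+\sum_jw_{ij}h(x_i,x_j,\lambda)$. It is diffusive if $h(z,z,\lambda)=0$ for all $z,\lambda$. With $g_0=\partial_xg(0,0)$ and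 $h_1=\partial_{x_1}h(0,0,0)$ (derivative in the first argument), the Jacobian at $x=0$, $\lambda=0$ is then $J^N=g_0\,\mathrm{id}+h_1L_N$. Standing assumption: the origin is an equilibrium for all $\lambda$, i.e. $g(0,\lambda)=0$. A bifurcation condition for $F^N$ is an equation $g_0+\mu h_1=0$ with $\mu$ an eigenvalue of $L_N$ (the condition associated with $\mu$; it makes $J^N$ singular). Standing genericity assumption: when the bifurcation condition associated with $\mu$ holds, $g_0+\tilde\mu h_1\ne0$ for every other eigenvalue $\tilde\mu\neq\mu$ of $L_N$. The condition is a bifurcation condition for $F^{N_i}$ if $\mu$ is an eigenvalue of $L_{N_i}$. (The eigenvalues of $L_N$ are those of $L_{N_1}$ together with those of $L_{N_2}$.) An equilibrium branch of $F^N$ is a continuous map $b:D\to\mathbb{R}^n$ with $F^N(b(\lambda),\lambda)=0$ on $D$ and $b(0)=0$, where $D$ is of the form $]-\epsilon,\epsilon[$, $[0,\epsilon[$ or $]-\epsilon,0]$ for some $\epsilon>0$. It is a bifurcation branch if $b\not\equiv0$. Branches are considered as germs at $\lambda=0$: $\epsilon$ may be shrunk, branches (on the same type of domain) agreeing near $0$ are identified, and $b\not\equiv0$ means not identically zero on any neighbourhood of $0$ in $D$. *)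

theory Defs
  imports "HOL-Analysis.Derivative" "Jordan_Normal_Form.Char_Poly"
begin

section \<open>Smooth functions\<close>

primrec C_times :: "nat \<Rightarrow> ('a::euclidean_space \<Rightarrow> 'b::real_normed_vector) \<Rightarrow> bool" where
  "C_times 0 f \<longleftrightarrow> continuous_on UNIV f"
| "C_times (Suc k) f \<longleftrightarrow>
     (\<forall>x. f differentiable (at x)) \<and> (\<forall>v. C_times k (\<lambda>x. frechet_derivative f (at x) v))"

definition smooth :: "('a::euclidean_space \<Rightarrow> 'b::real_normed_vector) \<Rightarrow> bool" where
  "smooth f \<longleftrightarrow> (\<forall>k. C_times k f)"

section \<open>Weighted networks\<close>

text \<open>A network with \<open>n\<close> cells is given by its weighted adjacency matrix; the cells are
  \<open>0, \<dots>, n - 1\<close>, and the entry at \<open>(i, j)\<close> is the weight of the edge from \<open>j\<close> to \<open>i\<close>.\<close>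

definition adjacent :: "real mat \<Rightarrow> (nat \<times> nat) set" where
  "adjacent W = {(i, j). i < dim_row W \<and> j < dim_row W \<and> (W $$ (i, j) \<noteq> 0 \<or> W $$ (j, i) \<noteq> 0)}"

definition network :: "nat \<Rightarrow> real mat \<Rightarrow> bool" where
  "network n W \<longleftrightarrow> 0 < n \<and> W \<in> carrier_mat n n \<and> (\<forall>i<n. \<forall>j<n. (i, j) \<in> (adjacent W)\<^sup>*)"

definition valency :: "real mat \<Rightarrow> nat \<Rightarrow> real" where
  "valency W i = (\<Sum>j<dim_col W. W $$ (i, j))"

definition laplacian :: "real mat \<Rightarrow> real mat" where
  "laplacian W = mat_diag (dim_row W) (valency W) - W"

text \<open>The cell \<open>c\<close> along which the networks are joined is the last cell of the first network and
  the first cell of the second one. In the coalescence the cells of the first network are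
  \<open>0, \<dots>, c\<close>, and cell \<open>k\<close> of the second network becomes cell \<open>c + k\<close>.\<close>

definition coalescence :: "real mat \<Rightarrow> real mat \<Rightarrow> real mat" where
  "coalescence W1 W2 =
    (let c = dim_row W1 - 1; n = dim_row W1 + dim_row W2 - 1 in
      mat n n (\<lambda>(a, b).
        if a = c \<and> b = c then W1 $$ (c, c) + W2 $$ (0, 0)
        else if a \<le> c \<and> b \<le> c then W1 $$ (a, b)
        else if c \<le> a \<and> c \<le> b then W2 $$ (a - c, b - c)
        else 0))"

definition feedforward_coalescence :: "nat \<Rightarrow> nat \<Rightarrow> real mat \<Rightarrow> real mat \<Rightarrow> bool" where
  "feedforward_coalescence n1 n2 W1 W2 \<longleftrightarrow>
     network n1 W1 \<and> network n2 W2 \<and> (\<forall>j. 0 < j \<and> j < n2 \<longrightarrow> W2 $$ (0, j) = 0)"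

section \<open>Admissible systems and bifurcation conditions\<close>

definition admissible ::
    "(real \<times> real \<Rightarrow> real) \<Rightarrow> (real \<times> real \<times> real \<Rightarrow> real) \<Rightarrow> real mat \<Rightarrow>
     real vec \<Rightarrow> real \<Rightarrow> real vec" where
  "admissible g h W x l =
     vec (dim_row W) (\<lambda>i. g (x $ i, l) + (\<Sum>j<dim_col W. W $$ (i, j) * h (x $ i, x $ j, l)))"

definition diffusive :: "(real \<times> real \<times> real \<Rightarrow> real) \<Rightarrow> bool" where
  "diffusive h \<longleftrightarrow> (\<forall>z l. h (z, z, l) = 0)"

definition g_deriv :: "(real \<times> real \<Rightarrow> real) \<Rightarrow> real" where
  "g_deriv g = deriv (\<lambda>x. g (x, 0)) 0"

definition h_deriv :: "(real \<times> real \<times> real \<Rightarrow> real) \<Rightarrow> real" where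
  "h_deriv h = deriv (\<lambda>x. h (x, 0, 0)) 0"

text \<open>The Laplacian need not be symmetric, so its eigenvalues are taken in the complex numbers.\<close>

definition laplacian_eigenvalue :: "real mat \<Rightarrow> complex \<Rightarrow> bool" where
  "laplacian_eigenvalue W \<mu> \<longleftrightarrow> eigenvalue (map_mat complex_of_real (laplacian W)) \<mu>"

definition bifurcation_condition ::
    "(real \<times> real \<Rightarrow> real) \<Rightarrow> (real \<times> real \<times> real \<Rightarrow> real) \<Rightarrow> real mat \<Rightarrow> complex \<Rightarrow> bool" where
  "bifurcation_condition g h W \<mu> \<longleftrightarrow>
     laplacian_eigenvalue W \<mu> \<and>
     complex_of_real (g_deriv g) + \<mu> * complex_of_real (h_deriv h) = 0"

definition generic_condition ::
    "(real \<times> real \<Rightarrow> real) \<Rightarrow> (real \<times> real \<times> real \<Rightarrow> real) \<Rightarrow> real mat \<Rightarrow> complex \<Rightarrow> bool" where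
  "generic_condition g h W \<mu> \<longleftrightarrow>
     (\<forall>\<nu>. laplacian_eigenvalue W \<nu> \<and> \<nu> \<noteq> \<mu> \<longrightarrow>
        complex_of_real (g_deriv g) + \<nu> * complex_of_real (h_deriv h) \<noteq> 0)"

section \<open>Branches\<close>

datatype side = Two_Sided | Right_Sided | Left_Sided

fun branch_dom :: "side \<Rightarrow> real \<Rightarrow> real set" where
  "branch_dom Two_Sided \<epsilon> = {-\<epsilon><..<\<epsilon>}"
| "branch_dom Right_Sided \<epsilon> = {0..<\<epsilon>}"
| "branch_dom Left_Sided \<epsilon> = {-\<epsilon><..0}"

definition equilibrium_branch_on ::
    "nat \<Rightarrow> (real vec \<Rightarrow> real \<Rightarrow> real vec) \<Rightarrow> real set \<Rightarrow> (real \<Rightarrow> real vec) \<Rightarrow> bool" where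
  "equilibrium_branch_on n F D b \<longleftrightarrow>
     (\<forall>l\<in>D. b l \<in> carrier_vec n) \<and>
     (\<forall>i<n. continuous_on D (\<lambda>l. b l $ i)) \<and>
     (\<forall>l\<in>D. F (b l) l = 0\<^sub>v n) \<and>
     b 0 = 0\<^sub>v n"

text \<open>Branches are germs at \<open>0\<close>: a function \<open>real \<Rightarrow> real vec\<close> together with a type of domain
  represents a germ through its values near \<open>0\<close> in that domain.\<close>

definition germ_eq :: "side \<Rightarrow> (real \<Rightarrow> 'a) \<Rightarrow> (real \<Rightarrow> 'a) \<Rightarrow> bool" where
  "germ_eq s b b' \<longleftrightarrow> (\<exists>\<epsilon>>0. \<forall>l\<in>branch_dom s \<epsilon>. b l = b' l)"

definition equilibrium_branch ::
    "nat \<Rightarrow> (real vec \<Rightarrow> real \<Rightarrow> real vec) \<Rightarrow> side \<Rightarrow> (real \<Rightarrow> real vec) \<Rightarrow> bool" where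
  "equilibrium_branch n F s b \<longleftrightarrow> (\<exists>\<epsilon>>0. equilibrium_branch_on n F (branch_dom s \<epsilon>) b)"

definition bifurcation_branch ::
    "nat \<Rightarrow> (real vec \<Rightarrow> real \<Rightarrow> real vec) \<Rightarrow> side \<Rightarrow> (real \<Rightarrow> real vec) \<Rightarrow> bool" where
  "bifurcation_branch n F s b \<longleftrightarrow>
     equilibrium_branch n F s b \<and> \<not> germ_eq s b (\<lambda>l. 0\<^sub>v n)"

abbreviation vec1 :: "real \<Rightarrow> real vec" where
  "vec1 x \<equiv> vec 1 (\<lambda>_. x)"

end

theory Submission
  imports "HOL-Probability.Discrete_Topology" Defs
begin

text \<open>
  Since \<open>h\<close> is diffusive and \<open>c\<close> receives no input from the other cells of \<open>N\<^sub>2\<close>, the equations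
  of \<open>N\<close> for the cells of \<open>N\<^sub>1\<close> are those of \<open>N\<^sub>1\<close>, the equation of \<open>N\<^sub>2\<close> at \<open>c\<close> is
  \<open>g(x\<^sub>c, \<lambda>) = 0\<close>, and the other equations of \<open>N\<^sub>2\<close> occur unchanged in \<open>N\<close>.

  If the bifurcation condition fails for one factor, genericity makes the Jacobian
  \<open>g\<^sub>0 id + h\<^sub>1 L\<close> of that factor invertible. As \<open>L\<close> annihilates constant vectors, this includes
  \<open>g\<^sub>0 \<noteq> 0\<close>. By the inverse function theorem, uniformly in \<open>\<lambda>\<close>, the vector field of the factor
  then acts bijectively on germs of curves through the origin.

  In (a), \<open>b\<^sub>2\<close> is obtained by solving \<open>F(x, \<lambda>) = g(b\<^sub>c(\<lambda>), \<lambda>) e\<^sub>c\<close> in \<open>N\<^sub>2\<close>: the equation at \<open>c\<close>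
  reads \<open>g(x\<^sub>c, \<lambda>) = g(b\<^sub>c(\<lambda>), \<lambda>)\<close>, which forces \<open>x\<^sub>c = b\<^sub>c\<close> because \<open>g\<^sub>0 \<noteq> 0\<close>. In (b), \<open>N\<^sub>1\<close> has
  only the trivial branch and \<open>g(b\<^sub>c, \<lambda>) = 0\<close> forces \<open>b\<^sub>c = 0\<close>, so that \<open>b\<^sub>1 = 0\<close> is the only
  completion.
\<close>

unbundle no vec_syntax

lemma diff_eq_0_vec_iff:
  fixes u v :: "'a::group_add vec"
  assumes "u \<in> carrier_vec n" "v \<in> carrier_vec n"
  shows "u - v = 0\<^sub>v n \<longleftrightarrow> u = v"
  using assms by (auto simp: vec_eq_iff)

section \<open>The supremum norm on vectors\<close>

definition sup_norm :: "real vec \<Rightarrow> real" where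
  "sup_norm v = Max (insert 0 ((\<lambda>i. \<bar>v $ i\<bar>) ` {..<dim_vec v}))"

lemma sup_norm_le_iff:
  "sup_norm v \<le> r \<longleftrightarrow> 0 \<le> r \<and> (\<forall>i<dim_vec v. \<bar>v $ i\<bar> \<le> r)"
  by (auto simp: sup_norm_def)

lemma sup_norm_nonneg: "0 \<le> sup_norm v"
  using sup_norm_le_iff by blast

lemma abs_index_le_sup_norm: "i < dim_vec v \<Longrightarrow> \<bar>v $ i\<bar> \<le> sup_norm v"
  using sup_norm_le_iff by blast

lemma sup_norm_0 [simp]: "sup_norm (0\<^sub>v n) = 0"
  using sup_norm_le_iff[of "0\<^sub>v n" 0] sup_norm_nonneg[of "0\<^sub>v n"] by simp

lemma eq_0_vec_if_sup_norm_le_0: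
  assumes "v \<in> carrier_vec n" "sup_norm v \<le> 0"
  shows "v = 0\<^sub>v n"
  using assms by (intro eq_vecI) (auto simp: sup_norm_le_iff)

lemma sup_norm_triangle_ineq:
  assumes "u \<in> carrier_vec n" "v \<in> carrier_vec n"
  shows "sup_norm (u + v) \<le> sup_norm u + sup_norm v"
  unfolding sup_norm_le_iff
proof (intro conjI allI impI add_nonneg_nonneg sup_norm_nonneg)
  fix i assume "i < dim_vec (u + v)"
  then show "\<bar>(u + v) $ i\<bar> \<le> sup_norm u + sup_norm v"
    using assms abs_index_le_sup_norm[of i u] abs_index_le_sup_norm[of i v] by simp
qed

lemma sup_norm_uminus: "sup_norm (- v) = sup_norm v"
proof -
  have "(\<lambda>i. \<bar>(- v) $ i\<bar>) ` {..<dim_vec v} = (\<lambda>i. \<bar>v $ i\<bar>) ` {..<dim_vec v}"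
    by (intro image_cong) auto
  then show ?thesis by (simp add: sup_norm_def)
qed

lemma tendsto_sup_norm_zero:
  assumes "\<forall>\<^sub>F t in F. v t \<in> carrier_vec n" and "\<And>i. i < n \<Longrightarrow> ((\<lambda>t. v t $ i) \<longlongrightarrow> 0) F"
  shows "((\<lambda>t. sup_norm (v t)) \<longlongrightarrow> 0) F"
proof (rule Lim_null_comparison)
  show "\<forall>\<^sub>F t in F. norm (sup_norm (v t)) \<le> (\<Sum>i<n. \<bar>v t $ i\<bar>)"
    using assms(1)
  proof eventually_elim
    case (elim t)
    then have "sup_norm (v t) \<le> (\<Sum>i<n. \<bar>v t $ i\<bar>)"
      unfolding sup_norm_le_iff
      by (auto intro!: sum_nonneg member_le_sum[where f = "\<lambda>i. \<bar>v t $ i\<bar>"])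
    then show ?case by (simp add: sup_norm_nonneg)
  qed
  show "((\<lambda>t. \<Sum>i<n. \<bar>v t $ i\<bar>) \<longlongrightarrow> 0) F"
    using assms(2) by (intro tendsto_null_sum tendsto_rabs_zero) auto
qed

definition entry_sum :: "real mat \<Rightarrow> real" where
  "entry_sum A = (\<Sum>i<dim_row A. \<Sum>j<dim_col A. \<bar>A $$ (i, j)\<bar>)"

lemma entry_sum_nonneg: "0 \<le> entry_sum A"
  unfolding entry_sum_def by (intro sum_nonneg) auto

lemma abs_row_sum_le:
  assumes "i < dim_row A" "0 \<le> m" and e: "\<And>j. j < dim_col A \<Longrightarrow> \<bar>e j\<bar> \<le> m"
  shows "\<bar>\<Sum>j<dim_col A. A $$ (i, j) * e j\<bar> \<le> entry_sum A * m"
proof -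
  have "\<bar>\<Sum>j<dim_col A. A $$ (i, j) * e j\<bar> \<le> (\<Sum>j<dim_col A. \<bar>A $$ (i, j)\<bar> * m)"
    using e by (intro order.trans[OF sum_abs] sum_mono) (auto simp: abs_mult intro: mult_left_mono)
  also have "\<dots> = (\<Sum>j<dim_col A. \<bar>A $$ (i, j)\<bar>) * m"
    by (simp add: sum_distrib_right)
  also have "\<dots> \<le> entry_sum A * m"
    unfolding entry_sum_def using assms(1,2)
    by (intro mult_right_mono member_le_sum[where f = "\<lambda>i. \<Sum>j<dim_col A. \<bar>A $$ (i, j)\<bar>"])
      (auto intro: sum_nonneg)
  finally show ?thesis .
qed

lemma sup_norm_mult_mat_vec_le:
  assumes "A \<in> carrier_mat m n" "v \<in> carrier_vec n"
  shows "sup_norm (A *\<^sub>v v) \<le> entry_sum A * sup_norm v"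
  unfolding sup_norm_le_iff
proof (intro conjI allI impI mult_nonneg_nonneg entry_sum_nonneg sup_norm_nonneg)
  fix i assume i: "i < dim_vec (A *\<^sub>v v)"
  then have "(A *\<^sub>v v) $ i = (\<Sum>j<dim_col A. A $$ (i, j) * v $ j)"
    using assms by (auto simp: scalar_prod_def lessThan_atLeast0 intro!: sum.cong)
  then show "\<bar>(A *\<^sub>v v) $ i\<bar> \<le> entry_sum A * sup_norm v"
    using abs_row_sum_le[of i A "sup_norm v" "($) v"] assms i abs_index_le_sup_norm[of _ v]
    by (auto simp: sup_norm_nonneg)
qed

definition vec_cball :: "nat \<Rightarrow> real \<Rightarrow> real vec set" where
  "vec_cball n r = {v \<in> carrier_vec n. sup_norm v \<le> r}"

text \<open>The dimension \<open>n\<close> is not a type, so Banach's theorem is applied in the space of bounded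
  sequences, in which vectors are padded with zeros.\<close>

definition bcontfun_of_vec :: "real vec \<Rightarrow> nat discrete \<Rightarrow>\<^sub>C real" where
  "bcontfun_of_vec v = Bcontfun (\<lambda>i. if of_discrete i < dim_vec v then v $ of_discrete i else 0)"

definition vec_of_bcontfun :: "nat \<Rightarrow> (nat discrete \<Rightarrow>\<^sub>C real) \<Rightarrow> real vec" where
  "vec_of_bcontfun n f = vec n (\<lambda>i. f (discrete i))"

lemma apply_bcontfun_of_vec:
  "bcontfun_of_vec v i = (if of_discrete i < dim_vec v then v $ of_discrete i else 0)"
  unfolding bcontfun_of_vec_def using abs_index_le_sup_norm[of _ v]
  by (subst Bcontfun_inverse)
    (auto intro!: bcontfun_normI[of _ "sup_norm v"] simp: sup_norm_nonneg
      continuous_on_open_vimage open_discrete)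

lemma vec_of_bcontfun_of_vec: "v \<in> carrier_vec n \<Longrightarrow> vec_of_bcontfun n (bcontfun_of_vec v) = v"
  by (intro eq_vecI) (auto simp: vec_of_bcontfun_def apply_bcontfun_of_vec discrete_inverse)

lemma norm_bcontfun_of_vec_le: "norm (bcontfun_of_vec v) \<le> sup_norm v"
  by (intro norm_bound) (auto simp: apply_bcontfun_of_vec abs_index_le_sup_norm sup_norm_nonneg)

lemma dist_bcontfun_of_vec_le:
  assumes "u \<in> carrier_vec n" "v \<in> carrier_vec n"
  shows "dist (bcontfun_of_vec u) (bcontfun_of_vec v) \<le> sup_norm (u - v)"
proof (rule dist_bound)
  fix i
  show "dist (bcontfun_of_vec u i) (bcontfun_of_vec v i) \<le> sup_norm (u - v)"
    using assms abs_index_le_sup_norm[of "of_discrete i" "u - v"]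
    by (auto simp: apply_bcontfun_of_vec dist_norm sup_norm_nonneg)
qed

lemma sup_norm_vec_of_bcontfun_le: "sup_norm (vec_of_bcontfun n f) \<le> norm f"
  using norm_bounded[of f] by (auto simp: vec_of_bcontfun_def sup_norm_le_iff)

lemma sup_norm_vec_of_bcontfun_diff_le:
  "sup_norm (vec_of_bcontfun n f - vec_of_bcontfun n g) \<le> dist f g"
  using dist_bounded[of f _ g] by (auto simp: vec_of_bcontfun_def sup_norm_le_iff dist_norm)

lemma vec_contraction_has_fixed_point:
  assumes "0 \<le> r" "0 \<le> c" "c < 1"
    and self: "\<And>x. x \<in> vec_cball n r \<Longrightarrow> T x \<in> vec_cball n r"
    and contraction: "\<And>x y. x \<in> vec_cball n r \<Longrightarrow> y \<in> vec_cball n r \<Longrightarrow>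
      sup_norm (T x - T y) \<le> c * sup_norm (x - y)"
  obtains x where "x \<in> vec_cball n r" "T x = x"
proof -
  have vec: "vec_of_bcontfun n f \<in> vec_cball n r" if "f \<in> cball 0 r" for f
    using that sup_norm_vec_of_bcontfun_le[of n f]
    by (simp add: vec_cball_def vec_of_bcontfun_def)
  define T' where "T' f = bcontfun_of_vec (T (vec_of_bcontfun n f))" for f
  have "\<exists>!f. f \<in> cball 0 r \<and> T' f = f"
  proof (rule Banach_fix[OF _ _ assms(2,3)])
    have "norm (T' f) \<le> r" if "f \<in> cball 0 r" for f
      using self[OF vec[OF that]] norm_bcontfun_of_vec_le[of "T (vec_of_bcontfun n f)"]
      by (simp add: T'_def vec_cball_def)
    then show "T' ` cball 0 r \<subseteq> cball 0 r"
      by auto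
    fix f g :: "nat discrete \<Rightarrow>\<^sub>C real" assume f: "f \<in> cball 0 r" and g: "g \<in> cball 0 r"
    have "dist (T' f) (T' g) \<le> sup_norm (T (vec_of_bcontfun n f) - T (vec_of_bcontfun n g))"
      using self[OF vec[OF f]] self[OF vec[OF g]] unfolding T'_def
      by (intro dist_bcontfun_of_vec_le) (auto simp: vec_cball_def)
    also have "\<dots> \<le> c * sup_norm (vec_of_bcontfun n f - vec_of_bcontfun n g)"
      by (rule contraction[OF vec[OF f] vec[OF g]])
    also have "\<dots> \<le> c * dist f g"
      using \<open>0 \<le> c\<close> by (intro mult_left_mono sup_norm_vec_of_bcontfun_diff_le)
    finally show "dist (T' f) (T' g) \<le> c * dist f g" .
  qed (use \<open>0 \<le> r\<close> in \<open>auto simp: complete_eq_closed\<close>)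
  then obtain f where f: "f \<in> cball 0 r" "T' f = f" by blast
  have "T (vec_of_bcontfun n f) = vec_of_bcontfun n (T' f)"
    using self[OF vec[OF f(1)]] by (simp add: T'_def vec_of_bcontfun_of_vec vec_cball_def)
  with f vec show ?thesis by (intro that[of "vec_of_bcontfun n f"]) simp_all
qed

section \<open>Perturbations of invertible matrices\<close>

locale near_linear =
  fixes n :: nat and A B :: "real mat" and f :: "real vec \<Rightarrow> real vec" and r :: real
  assumes A: "A \<in> carrier_mat n n" and B: "B \<in> carrier_mat n n"
    and left_inverse: "B * A = 1\<^sub>m n" and right_inverse: "A * B = 1\<^sub>m n"
    and f: "\<And>x. x \<in> carrier_vec n \<Longrightarrow> f x \<in> carrier_vec n"
    and near: "\<And>x y. x \<in> vec_cball n r \<Longrightarrow> y \<in> vec_cball n r \<Longrightarrow>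
      entry_sum B * sup_norm (f x - f y - A *\<^sub>v (x - y)) \<le> sup_norm (x - y) / 2"
begin

lemma sup_norm_linearization_error_le:
  assumes "x \<in> vec_cball n r" "y \<in> vec_cball n r"
  shows "sup_norm (x - y - B *\<^sub>v (f x - f y)) \<le> sup_norm (x - y) / 2"
proof -
  have x: "x \<in> carrier_vec n" and y: "y \<in> carrier_vec n"
    using assms by (auto simp: vec_cball_def)
  note fx = f[OF x] and fy = f[OF y]
  have "B *\<^sub>v (A *\<^sub>v (x - y)) = x - y"
    using A B x y left_inverse assoc_mult_mat_vec[of B n n A n "x - y"] by simp
  then have "B *\<^sub>v (f x - f y - A *\<^sub>v (x - y)) = - (x - y - B *\<^sub>v (f x - f y))"
    using A B x y fx fy by (subst mult_minus_distrib_mat_vec[of _ n n]) auto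
  then have "sup_norm (x - y - B *\<^sub>v (f x - f y)) = sup_norm (B *\<^sub>v (f x - f y - A *\<^sub>v (x - y)))"
    by (simp only: sup_norm_uminus)
  also have "\<dots> \<le> entry_sum B * sup_norm (f x - f y - A *\<^sub>v (x - y))"
    using A B x y fx fy by (intro sup_norm_mult_mat_vec_le) auto
  also note near[OF assms]
  finally show ?thesis .
qed

lemma sup_norm_diff_le:
  assumes "x \<in> vec_cball n r" "y \<in> vec_cball n r"
  shows "sup_norm (x - y) \<le> 2 * entry_sum B * sup_norm (f x - f y)"
proof -
  have x: "x \<in> carrier_vec n" and y: "y \<in> carrier_vec n"
    using assms by (auto simp: vec_cball_def)
  note fx = f[OF x] and fy = f[OF y]
  have "x - y = (x - y - B *\<^sub>v (f x - f y)) + B *\<^sub>v (f x - f y)"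
    using B x y fx fy by (intro eq_vecI) auto
  then have "sup_norm (x - y)
      \<le> sup_norm (x - y - B *\<^sub>v (f x - f y)) + sup_norm (B *\<^sub>v (f x - f y))"
    using sup_norm_triangle_ineq[of "x - y - B *\<^sub>v (f x - f y)" n "B *\<^sub>v (f x - f y)"] B x y fx fy
    by auto
  moreover have "sup_norm (B *\<^sub>v (f x - f y)) \<le> entry_sum B * sup_norm (f x - f y)"
    using B fx fy by (intro sup_norm_mult_mat_vec_le) auto
  ultimately show ?thesis
    using sup_norm_linearization_error_le[OF assms] by linarith
qed

definition newton_step :: "real vec \<Rightarrow> real vec \<Rightarrow> real vec" where
  "newton_step y x = x - B *\<^sub>v (f x - y)"

lemma newton_step_carrier:
  "x \<in> carrier_vec n \<Longrightarrow> y \<in> carrier_vec n \<Longrightarrow> newton_step y x \<in> carrier_vec n"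
  using B f[of x] by (simp add: newton_step_def)

lemma newton_step_contraction:
  assumes "x \<in> vec_cball n r" "x' \<in> vec_cball n r" and y: "y \<in> carrier_vec n"
  shows "sup_norm (newton_step y x - newton_step y x') \<le> 1 / 2 * sup_norm (x - x')"
proof -
  have x: "x \<in> carrier_vec n" and x': "x' \<in> carrier_vec n"
    using assms by (auto simp: vec_cball_def)
  note fx = f[OF x] and fx' = f[OF x']
  have "f x - f x' = (f x - y) - (f x' - y)"
    using fx fx' y by (intro eq_vecI) auto
  then have "newton_step y x - newton_step y x' = x - x' - B *\<^sub>v (f x - f x')"
    using B x x' fx fx' y
    by (intro eq_vecI) (auto simp: newton_step_def mult_minus_distrib_mat_vec[of _ n n]
        simp del: index_mult_mat_vec)
  then show ?thesis
    using sup_norm_linearization_error_le[OF assms(1,2)] by simp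
qed

lemma newton_step_in_vec_cball:
  assumes x: "x \<in> vec_cball n r" and y: "y \<in> carrier_vec n"
    and small: "2 * entry_sum B * sup_norm (y - f (0\<^sub>v n)) \<le> r"
  shows "newton_step y x \<in> vec_cball n r"
proof -
  have x_ball: "x \<in> carrier_vec n" "sup_norm x \<le> r"
    using x by (auto simp: vec_cball_def)
  then have zero: "0\<^sub>v n \<in> vec_cball n r"
    using sup_norm_nonneg[of x] by (simp add: vec_cball_def)
  note carrier = newton_step_carrier[OF x_ball(1) y] newton_step_carrier[OF zero_carrier_vec y]
  have "newton_step y (0\<^sub>v n) = B *\<^sub>v (y - f (0\<^sub>v n))"
    using B f y by (intro eq_vecI) (auto simp: newton_step_def mult_minus_distrib_mat_vec[of _ n n]
        simp del: index_mult_mat_vec)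
  then have "sup_norm (newton_step y (0\<^sub>v n)) \<le> r / 2"
    using small y f[of "0\<^sub>v n"] sup_norm_mult_mat_vec_le[OF B, of "y - f (0\<^sub>v n)"] by simp
  moreover have "sup_norm (newton_step y x - newton_step y (0\<^sub>v n)) \<le> r / 2"
    using newton_step_contraction[OF x zero y] x_ball by simp
  moreover have "newton_step y x = newton_step y x - newton_step y (0\<^sub>v n) + newton_step y (0\<^sub>v n)"
    using carrier by (intro eq_vecI) auto
  ultimately have "sup_norm (newton_step y x) \<le> r"
    using sup_norm_triangle_ineq[OF minus_carrier_vec[OF carrier] carrier(2)] by simp
  with carrier(1) show ?thesis by (simp add: vec_cball_def)
qed

lemma newton_step_fixed_point:
  assumes x: "x \<in> carrier_vec n" and y: "y \<in> carrier_vec n" and fixed: "newton_step y x = x"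
  shows "f x = y"
proof -
  have residual: "f x - y \<in> carrier_vec n" using f[OF x] y by simp
  have "B *\<^sub>v (f x - y) = x - newton_step y x"
    unfolding newton_step_def using B residual x
    by (intro eq_vecI) (auto simp del: index_mult_mat_vec)
  then have "B *\<^sub>v (f x - y) = 0\<^sub>v n"
    using x by (simp add: fixed)
  then have "A *\<^sub>v (B *\<^sub>v (f x - y)) = 0\<^sub>v n" using A by auto
  then show ?thesis
    using A B residual right_inverse assoc_mult_mat_vec[of A n n B n "f x - y"]
      diff_eq_0_vec_iff[OF f[OF x] y] by simp
qed

lemma solvable:
  assumes "0 \<le> r" "y \<in> carrier_vec n" "2 * entry_sum B * sup_norm (y - f (0\<^sub>v n)) \<le> r"
  obtains x where "x \<in> vec_cball n r" "f x = y"
proof -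
  obtain x where x: "x \<in> vec_cball n r" "newton_step y x = x"
    using vec_contraction_has_fixed_point[of r "1 / 2" n "newton_step y"] assms
      newton_step_contraction newton_step_in_vec_cball by auto
  moreover have "f x = y"
    using newton_step_fixed_point[OF _ assms(2) x(2)] x(1) by (simp add: vec_cball_def)
  ultimately show ?thesis by (intro that)
qed

end

section \<open>Strict differentiability\<close>

lemma continuously_differentiable_imp_strictly_differentiable:
  fixes f :: "'a::euclidean_space \<Rightarrow> 'b::real_normed_vector"
  assumes f: "C_times (Suc 0) f" and "\<delta> > 0"
  obtains r where "r > 0"
    and "\<And>p q. p \<in> cball a r \<Longrightarrow> q \<in> cball a r \<Longrightarrow>
      norm (f p - f q - frechet_derivative f (at a) (p - q)) \<le> \<delta> * norm (p - q)"
proof -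
  define f' where "f' x = Blinfun (frechet_derivative f (at x))" for x
  have deriv: "(f has_derivative frechet_derivative f (at x)) (at x)" for x
    using f by (simp add: frechet_derivative_works)
  then have f': "blinfun_apply (f' x) = frechet_derivative f (at x)" for x
    unfolding f'_def by (intro bounded_linear_Blinfun_apply has_derivative_bounded_linear)
  have "((\<lambda>x. f' x v) \<longlongrightarrow> f' a v) (nhds a)" for v
    using f by (simp add: f' continuous_on_eq_continuous_at isCont_def tendsto_nhds_iff)
  then have "(f' \<longlongrightarrow> f' a) (nhds a)"
    by (intro tendsto_componentwise1)
  then have "\<forall>\<^sub>F x in nhds a. dist (f' x) (f' a) < \<delta>"
    using \<open>\<delta> > 0\<close> by (rule tendstoD)
  then obtain r where r: "r > 0" "\<And>x. x \<in> cball a r \<Longrightarrow> dist (f' x) (f' a) < \<delta>"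
    unfolding eventually_nhds_metric_le by (auto simp: dist_commute)
  have "norm (f p - f q - f' a (p - q)) \<le> \<delta> * norm (p - q)"
    if "p \<in> cball a r" "q \<in> cball a r" for p q
    unfolding mult.commute[of \<delta>]
  proof (rule differentiable_bound_linearization[where S = "cball a r" and f' = "\<lambda>x. f' x"])
    fix t :: real assume "t \<in> {0..1}"
    then have "(1 - t) *\<^sub>R q + t *\<^sub>R p \<in> cball a r"
      using that by (intro convexD_alt) auto
    then show "q + t *\<^sub>R (p - q) \<in> cball a r"
      by (simp add: algebra_simps)
  next
    fix x assume "x \<in> cball a r"
    then show "onorm (blinfun_apply (f' x) - blinfun_apply (f' a)) \<le> \<delta>"
      using r(2)[of x]
      by (simp add: dist_norm norm_blinfun.rep_eq minus_blinfun.rep_eq fun_diff_def)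
    show "(f has_derivative f' x) (at x within cball a r)"
      using deriv by (simp add: f' has_derivative_at_withinI)
  qed (use r(1) in simp)
  with r(1) show ?thesis
    unfolding f' by (rule that)
qed

lemma has_real_derivative_along_line:
  fixes f :: "'a::real_normed_vector \<Rightarrow> real"
  assumes "f differentiable (at a)"
  shows "((\<lambda>t. f (a + t *\<^sub>R v)) has_real_derivative frechet_derivative f (at a) v) (at 0)"
proof -
  have "(f has_derivative frechet_derivative f (at a))
      (at (a + 0 *\<^sub>R v) within range (\<lambda>t. a + t *\<^sub>R v))"
    using assms by (simp add: frechet_derivative_works has_derivative_at_withinI)
  moreover have "((\<lambda>t. a + t *\<^sub>R v) has_vector_derivative v) (at 0)"
    by (auto intro!: derivative_eq_intros)
  ultimately show ?thesis
    using vector_derivative_diff_chain_within[of "\<lambda>t. a + t *\<^sub>R v" v 0 UNIV f]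
    by (simp add: o_def has_real_derivative_iff_has_vector_derivative)
qed

lemma C1_differentiable: "C_times (Suc 0) f \<Longrightarrow> f differentiable (at x)"
  unfolding C_times.simps by blast

lemma frechet_derivative_internal_dynamics:
  assumes diff: "g differentiable (at 0)"
  shows "frechet_derivative g (at 0) (x, 0) = g_deriv g * x"
proof -
  have "((\<lambda>t. g (t, 0)) has_real_derivative frechet_derivative g (at 0) (1, 0)) (at 0)"
    using has_real_derivative_along_line[OF diff, of "(1, 0)"] by simp
  then have "frechet_derivative g (at 0) (1, 0) = g_deriv g"
    unfolding g_deriv_def by (rule DERIV_imp_deriv[symmetric])
  then show ?thesis
    using linear_scale[OF linear_frechet_derivative[OF diff], of x "(1, 0)"] by simp
qed

lemma frechet_derivative_diffusive_coupling:
  assumes diff: "h differentiable (at 0)" and "diffusive h"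
  shows "frechet_derivative h (at 0) (x, y, 0) = h_deriv h * (x - y)"
proof -
  let ?D = "frechet_derivative h (at 0)"
  note linear = linear_frechet_derivative[OF diff]
  have "((\<lambda>t. h (t, 0, 0)) has_real_derivative ?D (1, 0, 0)) (at 0)"
    using has_real_derivative_along_line[OF diff, of "(1, 0, 0)"] by (simp add: zero_prod_def)
  then have D_first: "?D (1, 0, 0) = h_deriv h"
    unfolding h_deriv_def by (rule DERIV_imp_deriv[symmetric])
  have "((\<lambda>t. h (t, t, 0)) has_real_derivative ?D (1, 1, 0)) (at 0)"
    using has_real_derivative_along_line[OF diff, of "(1, 1, 0)"] by (simp add: zero_prod_def)
  moreover have "((\<lambda>t. h (t, t, 0)) has_real_derivative 0) (at 0)"
    using assms(2) by (simp add: diffusive_def)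
  ultimately have D_diagonal: "?D (1, 1, 0) = 0"
    by (rule DERIV_unique)
  have "?D (x, y, 0) = ?D ((x - y) *\<^sub>R (1, 0, 0) + y *\<^sub>R (1, 1, 0))"
    by simp
  also have "\<dots> = h_deriv h * (x - y)"
    by (simp only: linear_add[OF linear] linear_scale[OF linear] D_first D_diagonal) simp
  finally show ?thesis .
qed

lemma internal_dynamics_strictly_differentiable:
  assumes "C_times (Suc 0) g" "\<delta> > 0"
  obtains r where "r > 0"
    and "\<And>a b l. \<bar>a\<bar> \<le> r \<Longrightarrow> \<bar>b\<bar> \<le> r \<Longrightarrow> \<bar>l\<bar> \<le> r \<Longrightarrow>
      \<bar>g (a, l) - g (b, l) - g_deriv g * (a - b)\<bar> \<le> \<delta> * \<bar>a - b\<bar>"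
proof -
  from continuously_differentiable_imp_strictly_differentiable[OF assms, of 0]
  obtain r where r: "r > 0" "\<And>p q. norm p \<le> r \<Longrightarrow> norm q \<le> r \<Longrightarrow>
      norm (g p - g q - frechet_derivative g (at 0) (p - q)) \<le> \<delta> * norm (p - q)"
    by auto
  show ?thesis
  proof (rule that[of "r / 2"])
    fix a b l :: real assume "\<bar>a\<bar> \<le> r / 2" "\<bar>b\<bar> \<le> r / 2" "\<bar>l\<bar> \<le> r / 2"
    then have "norm (a, l) \<le> r" "norm (b, l) \<le> r"
      using norm_Pair_le[of a l] norm_Pair_le[of b l] by auto
    from r(2)[OF this] show "\<bar>g (a, l) - g (b, l) - g_deriv g * (a - b)\<bar> \<le> \<delta> * \<bar>a - b\<bar>"
      using frechet_derivative_internal_dynamics[OF C1_differentiable[OF assms(1)]]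
      by (simp add: norm_Pair)
  qed (use r(1) in simp)
qed

lemma diffusive_coupling_strictly_differentiable:
  assumes "C_times (Suc 0) h" "diffusive h" "\<delta> > 0"
  obtains r where "r > 0"
    and "\<And>a b u v l. \<bar>a\<bar> \<le> r \<Longrightarrow> \<bar>b\<bar> \<le> r \<Longrightarrow> \<bar>u\<bar> \<le> r \<Longrightarrow> \<bar>v\<bar> \<le> r \<Longrightarrow> \<bar>l\<bar> \<le> r \<Longrightarrow>
      \<bar>h (a, u, l) - h (b, v, l) - h_deriv h * ((a - b) - (u - v))\<bar> \<le> \<delta> * (\<bar>a - b\<bar> + \<bar>u - v\<bar>)"
proof -
  from continuously_differentiable_imp_strictly_differentiable[OF assms(1,3), of 0]
  obtain r where r: "r > 0" "\<And>p q. norm p \<le> r \<Longrightarrow> norm q \<le> r \<Longrightarrow>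
      norm (h p - h q - frechet_derivative h (at 0) (p - q)) \<le> \<delta> * norm (p - q)"
    by auto
  have norm_triple: "norm (a, b, c) \<le> \<bar>a\<bar> + \<bar>b\<bar> + \<bar>c\<bar>" for a b c :: real
    using norm_Pair_le[of a "(b, c)"] norm_Pair_le[of b c] by simp
  show ?thesis
  proof (rule that[of "r / 3"])
    fix a b u v l :: real
    assume "\<bar>a\<bar> \<le> r / 3" "\<bar>b\<bar> \<le> r / 3" "\<bar>u\<bar> \<le> r / 3" "\<bar>v\<bar> \<le> r / 3" "\<bar>l\<bar> \<le> r / 3"
    then have "norm (a, u, l) \<le> r" "norm (b, v, l) \<le> r"
      using norm_triple[of a u l] norm_triple[of b v l] by linarith+
    from r(2)[OF this]
    have "\<bar>h (a, u, l) - h (b, v, l) - h_deriv h * ((a - b) - (u - v))\<bar>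
        \<le> \<delta> * norm (a - b, u - v, 0::real)"
      using frechet_derivative_diffusive_coupling[OF C1_differentiable[OF assms(1)] assms(2)]
      by simp
    also have "\<dots> \<le> \<delta> * (\<bar>a - b\<bar> + \<bar>u - v\<bar>)"
      using norm_triple[of "a - b" "u - v" 0] assms(3) by (intro mult_left_mono) auto
    finally show "\<bar>h (a, u, l) - h (b, v, l) - h_deriv h * ((a - b) - (u - v))\<bar>
        \<le> \<delta> * (\<bar>a - b\<bar> + \<bar>u - v\<bar>)" .
  qed (use r(1) in simp)
qed

section \<open>The Jacobian of a network\<close>

lemma laplacian_carrier:
  "W \<in> carrier_mat n n \<Longrightarrow> laplacian W \<in> carrier_mat n n"
  by (auto simp: laplacian_def mat_diag_def)

lemma laplacian_mult_vec_index:
  assumes "W \<in> carrier_mat n n" "v \<in> carrier_vec n" "i < n"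
  shows "(laplacian W *\<^sub>v v) $ i = (\<Sum>j<n. W $$ (i, j) * (v $ i - v $ j))"
proof -
  have "(laplacian W *\<^sub>v v) $ i
    = (\<Sum>j<n. ((if i = j then valency W i else 0) - W $$ (i, j)) * v $ j)"
    using assms by (auto simp: laplacian_def mat_diag_def scalar_prod_def lessThan_atLeast0
        intro!: sum.cong)
  also have "\<dots> = (\<Sum>j<n. (if j = i then valency W i * v $ j else 0)) - (\<Sum>j<n. W $$ (i, j) * v $ j)"
    by (simp add: left_diff_distrib sum_subtractf if_distrib[where f = "\<lambda>x. x * _"] eq_commute
        cong: if_cong)
  also have "(\<Sum>j<n. (if j = i then valency W i * v $ j else 0)) = (\<Sum>j<n. W $$ (i, j) * v $ i)"
    using assms by (simp add: valency_def sum_distrib_right)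
  finally show ?thesis
    by (simp add: right_diff_distrib sum_subtractf)
qed

definition jacobian_matrix ::
    "(real \<times> real \<Rightarrow> real) \<Rightarrow> (real \<times> real \<times> real \<Rightarrow> real) \<Rightarrow> real mat \<Rightarrow> real mat" where
  "jacobian_matrix g h W = g_deriv g \<cdot>\<^sub>m 1\<^sub>m (dim_row W) + h_deriv h \<cdot>\<^sub>m laplacian W"

lemma jacobian_matrix_carrier:
  "W \<in> carrier_mat n n \<Longrightarrow> jacobian_matrix g h W \<in> carrier_mat n n"
  by (simp add: jacobian_matrix_def laplacian_carrier)

lemma jacobian_matrix_mult_vec:
  assumes "W \<in> carrier_mat n n" "v \<in> carrier_vec n"
  shows "jacobian_matrix g h W *\<^sub>v v = g_deriv g \<cdot>\<^sub>v v + h_deriv h \<cdot>\<^sub>v (laplacian W *\<^sub>v v)"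
proof -
  have "(k \<cdot>\<^sub>m M) *\<^sub>v v = k \<cdot>\<^sub>v (M *\<^sub>v v)" if "M \<in> carrier_mat n n" for k and M :: "real mat"
    using that assms(2) by (intro eq_vecI) auto
  then show ?thesis
    using assms laplacian_carrier[OF assms(1)]
    by (simp add: jacobian_matrix_def add_mult_distrib_mat_vec[of _ n n])
qed

lemma laplacian_mult_ones:
  assumes "W \<in> carrier_mat n n"
  shows "laplacian W *\<^sub>v vec n (\<lambda>_. 1) = 0\<^sub>v n"
  using assms laplacian_carrier[OF assms]
  by (intro eq_vecI) (auto simp: laplacian_mult_vec_index simp del: index_mult_mat_vec)

lemma ones_neq_zero_vec: "0 < n \<Longrightarrow> vec n (\<lambda>_. 1) \<noteq> (0\<^sub>v n :: 'a::zero_neq_one vec)"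
  by (metis index_vec index_zero_vec(1) zero_neq_one)

lemma laplacian_eigenvalue_of_real:
  assumes W: "W \<in> carrier_mat n n" and v: "v \<in> carrier_vec n" "v \<noteq> 0\<^sub>v n"
    and "laplacian W *\<^sub>v v = k \<cdot>\<^sub>v v"
  shows "laplacian_eigenvalue W (complex_of_real k)"
proof -
  have "eigenvector (laplacian W) v k"
    using assms laplacian_carrier[OF W] by (auto simp: eigenvector_def)
  from of_real_hom.eigenvector_hom[OF laplacian_carrier[OF W] this]
  show ?thesis
    unfolding laplacian_eigenvalue_def eigenvalue_def by blast
qed

lemma laplacian_eigenvalue_0:
  assumes "W \<in> carrier_mat n n" "0 < n"
  shows "laplacian_eigenvalue W 0"
proof -
  have "laplacian W *\<^sub>v vec n (\<lambda>_. 1) = 0 \<cdot>\<^sub>v vec n (\<lambda>_. 1)"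
    unfolding laplacian_mult_ones[OF assms(1)] by (intro eq_vecI) auto
  with laplacian_eigenvalue_of_real[OF assms(1) vec_carrier ones_neq_zero_vec[OF assms(2)]]
  show ?thesis by fastforce
qed

lemma g_deriv_neq_0_if_nonsingular:
  assumes W: "W \<in> carrier_mat n n" "0 < n" and "det (jacobian_matrix g h W) \<noteq> 0"
  shows "g_deriv g \<noteq> 0"
proof
  assume "g_deriv g = 0"
  then have "jacobian_matrix g h W *\<^sub>v vec n (\<lambda>_. 1) = 0\<^sub>v n"
    unfolding jacobian_matrix_mult_vec[OF W(1) vec_carrier] laplacian_mult_ones[OF W(1)]
    by (intro eq_vecI) auto
  with assms(3) ones_neq_zero_vec[OF W(2)] show False
    using det_0_iff_vec_prod_zero[OF jacobian_matrix_carrier[OF W(1)]] by (metis vec_carrier)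
qed

lemma nonsingular_if_not_bifurcation_condition:
  assumes N: "N \<in> carrier_mat m m" "0 < m"
      "bifurcation_condition g h N \<mu>" "generic_condition g h N \<mu>"
    and W: "W \<in> carrier_mat n n" "0 < n" "\<not> bifurcation_condition g h W \<mu>"
  shows "det (jacobian_matrix g h W) \<noteq> 0"
proof
  assume "det (jacobian_matrix g h W) = 0"
  then obtain v where v: "v \<in> carrier_vec n" "v \<noteq> 0\<^sub>v n" "jacobian_matrix g h W *\<^sub>v v = 0\<^sub>v n"
    using det_0_iff_vec_prod_zero[OF jacobian_matrix_carrier[OF W(1)]] by blast
  have \<mu>: "complex_of_real (g_deriv g) + \<mu> * complex_of_real (h_deriv h) = 0"
    and not_eigenvalue: "\<not> laplacian_eigenvalue W \<mu>"
    using N(3) W(3) by (auto simp: bifurcation_condition_def)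
  then have "\<mu> \<noteq> 0"
    using laplacian_eigenvalue_0[OF W(1,2)] by blast
  then have "g_deriv g \<noteq> 0"
    using N(4) laplacian_eigenvalue_0[OF N(1,2)] by (auto simp: generic_condition_def)
  with \<mu> have h_deriv_neq_0: "h_deriv h \<noteq> 0" by auto
  have kernel: "g_deriv g \<cdot>\<^sub>v v + h_deriv h \<cdot>\<^sub>v (laplacian W *\<^sub>v v) = 0\<^sub>v n"
    using v jacobian_matrix_mult_vec[OF W(1) v(1)] by simp
  have "laplacian W *\<^sub>v v = (- g_deriv g / h_deriv h) \<cdot>\<^sub>v v"
  proof (rule eq_vecI)
    fix i assume "i < dim_vec ((- g_deriv g / h_deriv h) \<cdot>\<^sub>v v)"
    then show "(laplacian W *\<^sub>v v) $ i = ((- g_deriv g / h_deriv h) \<cdot>\<^sub>v v) $ i"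
      using arg_cong[OF kernel, of "\<lambda>u. u $ i"] v(1) laplacian_carrier[OF W(1)] h_deriv_neq_0
      by (simp add: field_simps add_eq_0_iff del: index_mult_mat_vec)
  qed (use v(1) laplacian_carrier[OF W(1)] in auto)
  then have "laplacian_eigenvalue W (complex_of_real (- g_deriv g / h_deriv h))"
    using laplacian_eigenvalue_of_real[OF W(1) v(1,2)] by blast
  also have "complex_of_real (- g_deriv g / h_deriv h) = \<mu>"
    using \<mu> h_deriv_neq_0 by (simp add: field_simps add_eq_0_iff)
  finally show False
    using not_eigenvalue by blast
qed

section \<open>Local inversion of the vector field of a network\<close>

lemma admissible_carrier:
  "W \<in> carrier_mat n n \<Longrightarrow> admissible g h W x l \<in> carrier_vec n"
  by (auto simp: admissible_def)

lemma admissible_index: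
  assumes "W \<in> carrier_mat n n" "i < n"
  shows "admissible g h W x l $ i = g (x $ i, l) + (\<Sum>j<n. W $$ (i, j) * h (x $ i, x $ j, l))"
  using assms by (auto simp: admissible_def)

lemma admissible_linearization_error_index:
  assumes W: "W \<in> carrier_mat n n" and x: "x \<in> carrier_vec n" and y: "y \<in> carrier_vec n"
    and i: "i < n"
  shows "(admissible g h W x l - admissible g h W y l - jacobian_matrix g h W *\<^sub>v (x - y)) $ i =
    (g (x $ i, l) - g (y $ i, l) - g_deriv g * (x $ i - y $ i)) +
    (\<Sum>j<n. W $$ (i, j) * (h (x $ i, x $ j, l) - h (y $ i, y $ j, l)
      - h_deriv h * ((x $ i - y $ i) - (x $ j - y $ j))))"
proof -
  have xy: "x - y \<in> carrier_vec n" using x y by simp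
  have "(jacobian_matrix g h W *\<^sub>v (x - y)) $ i
      = g_deriv g * (x $ i - y $ i) + h_deriv h * (laplacian W *\<^sub>v (x - y)) $ i"
    unfolding jacobian_matrix_mult_vec[OF W xy] using x y i laplacian_carrier[OF W]
    by (simp del: index_mult_mat_vec)
  also have "(laplacian W *\<^sub>v (x - y)) $ i
      = (\<Sum>j<n. W $$ (i, j) * ((x $ i - y $ i) - (x $ j - y $ j)))"
    unfolding laplacian_mult_vec_index[OF W xy i] using x y i by (intro sum.cong) auto
  also have "g_deriv g * (x $ i - y $ i) + h_deriv h * \<dots> = g_deriv g * (x $ i - y $ i) +
      (\<Sum>j<n. W $$ (i, j) * (h_deriv h * ((x $ i - y $ i) - (x $ j - y $ j))))"
    by (simp add: sum_distrib_left mult.left_commute)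
  finally show ?thesis
    using admissible_index[OF W i] carrier_vecD[OF admissible_carrier[OF W]] i
      carrier_matD[OF jacobian_matrix_carrier[OF W]]
    by (simp add: sum_subtractf right_diff_distrib del: index_mult_mat_vec(1))
qed

lemma admissible_linearization_error_index_le:
  assumes W: "W \<in> carrier_mat n n" and "0 \<le> \<eta>" and i: "i < n"
    and x: "x \<in> vec_cball n r" and y: "y \<in> vec_cball n r"
    and g: "\<And>a b. \<bar>a\<bar> \<le> r \<Longrightarrow> \<bar>b\<bar> \<le> r \<Longrightarrow>
      \<bar>g (a, l) - g (b, l) - g_deriv g * (a - b)\<bar> \<le> \<eta> * \<bar>a - b\<bar>"
    and h: "\<And>a b u v. \<bar>a\<bar> \<le> r \<Longrightarrow> \<bar>b\<bar> \<le> r \<Longrightarrow> \<bar>u\<bar> \<le> r \<Longrightarrow> \<bar>v\<bar> \<le> r \<Longrightarrow>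
      \<bar>h (a, u, l) - h (b, v, l) - h_deriv h * ((a - b) - (u - v))\<bar> \<le> \<eta> * (\<bar>a - b\<bar> + \<bar>u - v\<bar>)"
  shows "\<bar>(admissible g h W x l - admissible g h W y l - jacobian_matrix g h W *\<^sub>v (x - y)) $ i\<bar>
    \<le> \<eta> * (1 + 2 * entry_sum W) * sup_norm (x - y)" (is "\<bar>?err $ i\<bar> \<le> _ * ?M")
proof -
  have carrier: "x \<in> carrier_vec n" "y \<in> carrier_vec n"
    using x y by (auto simp: vec_cball_def)
  have bound: "\<bar>x $ j\<bar> \<le> r" "\<bar>y $ j\<bar> \<le> r" if "j < n" for j
    using x y that by (auto simp: vec_cball_def sup_norm_le_iff)
  have M: "\<bar>x $ j - y $ j\<bar> \<le> ?M" if "j < n" for j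
    using that carrier abs_index_le_sup_norm[of j "x - y"] by simp
  define G where "G = g (x $ i, l) - g (y $ i, l) - g_deriv g * (x $ i - y $ i)"
  define H where "H j = h (x $ i, x $ j, l) - h (y $ i, y $ j, l)
    - h_deriv h * ((x $ i - y $ i) - (x $ j - y $ j))" for j
  have "\<bar>G\<bar> \<le> \<eta> * \<bar>x $ i - y $ i\<bar>"
    unfolding G_def using bound[OF i] by (rule g)
  also have "\<dots> \<le> \<eta> * ?M"
    using M[OF i] \<open>0 \<le> \<eta>\<close> by (rule mult_left_mono)
  finally have G: "\<bar>G\<bar> \<le> \<eta> * ?M" .
  have H: "\<bar>H j\<bar> \<le> \<eta> * (2 * ?M)" if j: "j < n" for j
  proof -
    have "\<bar>H j\<bar> \<le> \<eta> * (\<bar>x $ i - y $ i\<bar> + \<bar>x $ j - y $ j\<bar>)"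
      unfolding H_def using bound[OF i] bound[OF j] by (rule h)
    also have "\<dots> \<le> \<eta> * (2 * ?M)"
      using M[OF i] M[OF j] \<open>0 \<le> \<eta>\<close> by (intro mult_left_mono) auto
    finally show ?thesis .
  qed
  have "\<bar>\<Sum>j<n. W $$ (i, j) * H j\<bar> \<le> entry_sum W * (\<eta> * (2 * ?M))"
    using abs_row_sum_le[of i W "\<eta> * (2 * ?M)" H] H W i \<open>0 \<le> \<eta>\<close> sup_norm_nonneg[of "x - y"]
    by simp
  moreover have "?err $ i = G + (\<Sum>j<n. W $$ (i, j) * H j)"
    unfolding G_def H_def by (rule admissible_linearization_error_index[OF W carrier i])
  ultimately show ?thesis
    using G by (simp add: algebra_simps)
qed

lemma admissible_strictly_differentiable:
  assumes gh: "C_times (Suc 0) g" "C_times (Suc 0) h" "diffusive h"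
    and W: "W \<in> carrier_mat n n" and "\<delta> > 0"
  obtains r where "r > 0"
    and "\<And>x y l. x \<in> vec_cball n r \<Longrightarrow> y \<in> vec_cball n r \<Longrightarrow> \<bar>l\<bar> \<le> r \<Longrightarrow>
      sup_norm (admissible g h W x l - admissible g h W y l - jacobian_matrix g h W *\<^sub>v (x - y))
        \<le> \<delta> * sup_norm (x - y)"
proof -
  define \<eta> where "\<eta> = \<delta> / (1 + 2 * entry_sum W)"
  have \<eta>: "\<eta> > 0" "\<eta> * (1 + 2 * entry_sum W) = \<delta>"
    using \<open>\<delta> > 0\<close> entry_sum_nonneg[of W] by (auto simp: \<eta>_def)
  obtain r1 where r1: "r1 > 0" and g: "\<And>a b l. \<bar>a\<bar> \<le> r1 \<Longrightarrow> \<bar>b\<bar> \<le> r1 \<Longrightarrow> \<bar>l\<bar> \<le> r1 \<Longrightarrow>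
      \<bar>g (a, l) - g (b, l) - g_deriv g * (a - b)\<bar> \<le> \<eta> * \<bar>a - b\<bar>"
    using internal_dynamics_strictly_differentiable[OF gh(1) \<eta>(1)] by blast
  obtain r2 where r2: "r2 > 0" and h: "\<And>a b u v l.
      \<bar>a\<bar> \<le> r2 \<Longrightarrow> \<bar>b\<bar> \<le> r2 \<Longrightarrow> \<bar>u\<bar> \<le> r2 \<Longrightarrow> \<bar>v\<bar> \<le> r2 \<Longrightarrow> \<bar>l\<bar> \<le> r2 \<Longrightarrow>
      \<bar>h (a, u, l) - h (b, v, l) - h_deriv h * ((a - b) - (u - v))\<bar> \<le> \<eta> * (\<bar>a - b\<bar> + \<bar>u - v\<bar>)"
    using diffusive_coupling_strictly_differentiable[OF gh(2,3) \<eta>(1)] by blast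
  show ?thesis
  proof (rule that[of "min r1 r2"])
    fix x y l
    assume xyl: "x \<in> vec_cball n (min r1 r2)" "y \<in> vec_cball n (min r1 r2)" "\<bar>l\<bar> \<le> min r1 r2"
    let ?err = "admissible g h W x l - admissible g h W y l - jacobian_matrix g h W *\<^sub>v (x - y)"
    have "\<bar>?err $ i\<bar> \<le> \<delta> * sup_norm (x - y)" if "i < n" for i
      unfolding \<eta>(2)[symmetric] using \<eta>(1) g h that xyl
      by (intro admissible_linearization_error_index_le[OF W]) auto
    moreover have "dim_vec ?err = n"
      using carrier_matD(1)[OF jacobian_matrix_carrier[OF W]] by simp
    ultimately show "sup_norm ?err \<le> \<delta> * sup_norm (x - y)"
      unfolding sup_norm_le_iff using \<open>\<delta> > 0\<close> sup_norm_nonneg[of "x - y"] by simp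
  qed (use r1 r2 in auto)
qed

locale diffusive_system =
  fixes g :: "real \<times> real \<Rightarrow> real" and h :: "real \<times> real \<times> real \<Rightarrow> real"
  assumes C1_g: "C_times (Suc 0) g" and C1_h: "C_times (Suc 0) h"
    and diffusive: "diffusive h"
    and g_0: "\<And>l. g (0, l) = 0"
begin

lemma admissible_0:
  assumes "W \<in> carrier_mat n n"
  shows "admissible g h W (0\<^sub>v n) l = 0\<^sub>v n"
  using assms diffusive g_0 by (intro eq_vecI) (auto simp: admissible_def diffusive_def)

lemma near_linear_admissible:
  assumes W: "W \<in> carrier_mat n n" and B: "B \<in> carrier_mat n n"
    and inverse: "B * jacobian_matrix g h W = 1\<^sub>m n" "jacobian_matrix g h W * B = 1\<^sub>m n"
  obtains r where "0 < r"
    and "\<And>l. \<bar>l\<bar> \<le> r \<Longrightarrow> near_linear n (jacobian_matrix g h W) B (\<lambda>x. admissible g h W x l) r"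
proof -
  let ?J = "jacobian_matrix g h W" and ?F = "admissible g h W"
  define k where "k = 1 + entry_sum B"
  have k: "k > 0" "entry_sum B \<le> k" using entry_sum_nonneg[of B] by (auto simp: k_def)
  obtain r where r: "r > 0" and error:
    "\<And>x y l. x \<in> vec_cball n r \<Longrightarrow> y \<in> vec_cball n r \<Longrightarrow> \<bar>l\<bar> \<le> r \<Longrightarrow>
      sup_norm (?F x l - ?F y l - ?J *\<^sub>v (x - y)) \<le> 1 / (2 * k) * sup_norm (x - y)"
    using admissible_strictly_differentiable[OF C1_g C1_h diffusive W, of "1 / (2 * k)"] k
    by auto
  have "near_linear n ?J B (\<lambda>x. ?F x l) r" if "\<bar>l\<bar> \<le> r" for l
  proof
    fix x y assume xy: "x \<in> vec_cball n r" "y \<in> vec_cball n r"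
    have "entry_sum B * sup_norm (?F x l - ?F y l - ?J *\<^sub>v (x - y))
        \<le> k * (1 / (2 * k) * sup_norm (x - y))"
      using k error[OF xy that] by (intro mult_mono) (auto simp: sup_norm_nonneg)
    then show "entry_sum B * sup_norm (?F x l - ?F y l - ?J *\<^sub>v (x - y)) \<le> sup_norm (x - y) / 2"
      using k by simp
  qed (use B inverse in \<open>auto intro: jacobian_matrix_carrier[OF W] admissible_carrier[OF W]\<close>)
  with r show ?thesis by (rule that)
qed

lemma admissible_local_inverse:
  assumes W: "W \<in> carrier_mat n n" and det: "det (jacobian_matrix g h W) \<noteq> 0"
  obtains r \<rho> K where "0 < r" "0 < \<rho>"
    and "\<And>l x y. \<bar>l\<bar> \<le> r \<Longrightarrow> x \<in> vec_cball n r \<Longrightarrow> y \<in> vec_cball n r \<Longrightarrow>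
      sup_norm (x - y) \<le> K * sup_norm (admissible g h W x l - admissible g h W y l)"
    and "\<And>l y. \<bar>l\<bar> \<le> r \<Longrightarrow> y \<in> vec_cball n \<rho> \<Longrightarrow>
      \<exists>x \<in> vec_cball n r. admissible g h W x l = y"
proof -
  let ?J = "jacobian_matrix g h W" and ?F = "admissible g h W"
  obtain B where B: "B \<in> carrier_mat n n" "B * ?J = 1\<^sub>m n" "?J * B = 1\<^sub>m n"
    using det_non_zero_imp_unit[OF jacobian_matrix_carrier[OF W] det]
    by (auto simp: Units_def ring_mat_simps)
  obtain r where r: "0 < r" and near: "\<And>l. \<bar>l\<bar> \<le> r \<Longrightarrow> near_linear n ?J B (\<lambda>x. ?F x l) r"
    using near_linear_admissible[OF W B] by blast
  define K where "K = 2 * entry_sum B"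
  have K: "0 \<le> K" by (simp add: K_def entry_sum_nonneg)
  show ?thesis
  proof (rule that[of r "r / (1 + K)" K])
    show "sup_norm (x - y) \<le> K * sup_norm (?F x l - ?F y l)"
      if "\<bar>l\<bar> \<le> r" "x \<in> vec_cball n r" "y \<in> vec_cball n r" for l x y
      unfolding K_def using near_linear.sup_norm_diff_le[OF near] that by blast
    show "\<exists>x \<in> vec_cball n r. ?F x l = y"
      if l: "\<bar>l\<bar> \<le> r" and "y \<in> vec_cball n (r / (1 + K))" for l y
    proof -
      have y: "y \<in> carrier_vec n" "sup_norm y \<le> r / (1 + K)"
        using that by (auto simp: vec_cball_def)
      have "K * sup_norm y \<le> (1 + K) * (r / (1 + K))"
        using K y(2) by (intro mult_mono) (auto simp: sup_norm_nonneg)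
      moreover have "y - ?F (0\<^sub>v n) l = y"
        using y(1) by (simp add: admissible_0[OF W])
      ultimately show ?thesis
        using near_linear.solvable[OF near[OF l] _ y(1)] K r by (auto simp: K_def)
    qed
  qed (use r K in auto)
qed

end

section \<open>Germs of curves through the origin\<close>

fun branch_side :: "side \<Rightarrow> real set" where
  "branch_side Two_Sided = UNIV"
| "branch_side Right_Sided = {0..}"
| "branch_side Left_Sided = {..0}"

lemma branch_dom_eq: "branch_dom s \<epsilon> = branch_side s \<inter> ball 0 \<epsilon>"
  by (cases s) auto

lemma zero_in_branch_side [simp]: "0 \<in> branch_side s"
  by (cases s) auto

definition germ_filter :: "side \<Rightarrow> real filter" where
  "germ_filter s = inf (nhds 0) (principal (branch_side s))"

lemma eventually_germ_filter:
  "eventually P (germ_filter s) \<longleftrightarrow> (\<exists>\<epsilon>>0. \<forall>l\<in>branch_dom s \<epsilon>. P l)"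
  unfolding germ_filter_def eventually_inf_principal eventually_nhds_metric
  by (auto simp: branch_dom_eq dist_commute)

lemma germ_eq_iff_eventually:
  "germ_eq s b b' \<longleftrightarrow> (\<forall>\<^sub>F l in germ_filter s. b l = b' l)"
  by (simp add: germ_eq_def eventually_germ_filter)

lemma eventually_germ_filter_at_0: "eventually P (germ_filter s) \<Longrightarrow> P 0"
  by (auto simp: eventually_germ_filter branch_dom_eq)

lemma eventually_germ_filter_abs_le: "0 < r \<Longrightarrow> \<forall>\<^sub>F l in germ_filter s. \<bar>l\<bar> \<le> r"
  unfolding eventually_germ_filter by (intro exI[of _ r]) (auto simp: branch_dom_eq)

lemma eventually_germ_filter_within:
  assumes "eventually P (germ_filter s)"
  shows "\<forall>\<^sub>F l0 in germ_filter s. \<forall>\<^sub>F l in at l0 within branch_side s. P l"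
proof -
  have "\<forall>\<^sub>F l0 in nhds 0. \<forall>\<^sub>F l in nhds l0. l \<in> branch_side s \<longrightarrow> P l"
    using assms by (simp add: germ_filter_def eventually_inf_principal eventually_eventually)
  then show ?thesis
    unfolding germ_filter_def eventually_inf_principal eventually_at_filter
    by (auto elim!: eventually_mono)
qed

lemma continuous_on_branch_dom_iff:
  "continuous_on (branch_dom s \<epsilon>) f \<longleftrightarrow>
    (\<forall>l\<in>branch_dom s \<epsilon>. continuous (at l within branch_side s) f)"
proof -
  have "at l within branch_dom s \<epsilon> = at l within branch_side s" if "l \<in> branch_dom s \<epsilon>" for l
    using that by (intro at_within_nhd[of l "ball 0 \<epsilon>"]) (auto simp: branch_dom_eq)
  then show ?thesis
    by (simp add: continuous_on_eq_continuous_within)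
qed

definition curve_germ :: "nat \<Rightarrow> side \<Rightarrow> (real \<Rightarrow> real vec) \<Rightarrow> bool" where
  "curve_germ n s b \<longleftrightarrow> b 0 = 0\<^sub>v n \<and> (\<forall>\<^sub>F l in germ_filter s. b l \<in> carrier_vec n) \<and>
    (\<forall>i<n. \<forall>\<^sub>F l in germ_filter s. continuous (at l within branch_side s) (\<lambda>l. b l $ i))"

lemma equilibrium_branch_iff_curve_germ:
  "equilibrium_branch n F s b \<longleftrightarrow>
    curve_germ n s b \<and> (\<forall>\<^sub>F l in germ_filter s. F (b l) l = 0\<^sub>v n)"
proof -
  have "equilibrium_branch n F s b \<longleftrightarrow> b 0 = 0\<^sub>v n \<and> (\<forall>\<^sub>F l in germ_filter s. b l \<in> carrier_vec n \<and>
      (\<forall>i<n. continuous (at l within branch_side s) (\<lambda>l. b l $ i)) \<and> F (b l) l = 0\<^sub>v n)"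
    unfolding equilibrium_branch_def equilibrium_branch_on_def eventually_germ_filter
      continuous_on_branch_dom_iff by blast
  moreover have
    "(\<forall>\<^sub>F l in germ_filter s. \<forall>i<n. continuous (at l within branch_side s) (\<lambda>l. b l $ i)) \<longleftrightarrow>
      (\<forall>i<n. \<forall>\<^sub>F l in germ_filter s. continuous (at l within branch_side s) (\<lambda>l. b l $ i))"
    using eventually_ball_finite_distrib[of "{..<n}"] by (simp add: Ball_def)
  ultimately show ?thesis
    by (auto simp: curve_germ_def eventually_conj_iff)
qed

lemma curve_germ_zero: "curve_germ n s (\<lambda>l. 0\<^sub>v n)"
  by (simp add: curve_germ_def)

lemma all_less_add_iff:
  fixes m n :: nat
  shows "(\<forall>i<m + n. P i) \<longleftrightarrow> (\<forall>i<m. P i) \<and> (\<forall>i<n. P (m + i))"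
  by (metis add_less_cancel_left le_add_diff_inverse not_le trans_less_add1)

lemma append_eq_zero_vec_iff:
  fixes u v :: "'a::zero vec"
  assumes "u \<in> carrier_vec m"
  shows "u @\<^sub>v v = 0\<^sub>v (m + n) \<longleftrightarrow> u = 0\<^sub>v m \<and> v = 0\<^sub>v n"
proof -
  have "0\<^sub>v (m + n) = 0\<^sub>v m @\<^sub>v (0\<^sub>v n :: 'a vec)" by (intro eq_vecI) auto
  then show ?thesis using append_vec_eq[OF assms zero_carrier_vec] by simp
qed

lemma curve_germ_append_iff:
  assumes u: "\<And>l. u l \<in> carrier_vec m" and v: "\<And>l. v l \<in> carrier_vec n"
  shows "curve_germ (m + n) s (\<lambda>l. u l @\<^sub>v v l) \<longleftrightarrow> curve_germ m s u \<and> curve_germ n s v"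
proof -
  have "(u l @\<^sub>v v l) $ i = u l $ i" if "i < m" for i l
    using that carrier_vecD[OF u[of l]] carrier_vecD[OF v[of l]] by simp
  moreover have "(u l @\<^sub>v v l) $ (m + i) = v l $ i" if "i < n" for i l
    using that carrier_vecD[OF u[of l]] carrier_vecD[OF v[of l]] by simp
  ultimately show ?thesis
    using u v by (auto simp: curve_germ_def all_less_add_iff append_eq_zero_vec_iff[OF u])
qed

lemma germ_eq_zero_append_iff:
  assumes "\<And>l. u l \<in> carrier_vec m"
  shows "germ_eq s (\<lambda>l. u l @\<^sub>v v l) (\<lambda>l. 0\<^sub>v (m + n)) \<longleftrightarrow>
    germ_eq s u (\<lambda>l. 0\<^sub>v m) \<and> germ_eq s v (\<lambda>l. 0\<^sub>v n)"
  by (simp add: germ_eq_iff_eventually append_eq_zero_vec_iff[OF assms] eventually_conj_iff)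

lemma vec1_eq_iff: "vec1 x = vec1 y \<longleftrightarrow> x = y"
  by (auto simp: vec_eq_iff)

lemma zero_vec_1: "0\<^sub>v 1 = vec1 0"
  by (intro eq_vecI) auto

lemma vec1_append_vec_last:
  assumes "v \<in> carrier_vec (1 + m)"
  shows "vec1 (v $ 0) @\<^sub>v vec_last v m = v"
proof -
  have "vec_first v 1 = vec1 (v $ 0)"
    by (intro eq_vecI) (auto simp: vec_first_def)
  then show ?thesis
    using vec_first_last_append[OF assms] by simp
qed

lemma germ_eq_vec1_iff: "germ_eq s (\<lambda>l. vec1 (a l)) (\<lambda>l. vec1 (b l)) \<longleftrightarrow> germ_eq s a b"
  by (simp add: germ_eq_def vec1_eq_iff del: One_nat_def)

lemma curve_germ_eventually_in_vec_cball:
  assumes b: "curve_germ n s b" and "0 < r"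
  shows "\<forall>\<^sub>F l in germ_filter s. b l \<in> vec_cball n r"
proof -
  have "\<forall>\<^sub>F l in germ_filter s. \<bar>b l $ i\<bar> \<le> r" if "i < n" for i
  proof -
    have "continuous (at 0 within branch_side s) (\<lambda>l. b l $ i)"
      using b that by (intro eventually_germ_filter_at_0) (auto simp: curve_germ_def)
    then have "((\<lambda>l. b l $ i) \<longlongrightarrow> 0) (germ_filter s)"
      using b that tendsto_at_within_iff_tendsto_nhds[of "\<lambda>l. b l $ i" 0]
      by (simp add: continuous_within curve_germ_def germ_filter_def)
    then have "\<forall>\<^sub>F l in germ_filter s. dist (b l $ i) 0 < r"
      using \<open>0 < r\<close> by (rule tendstoD)
    then show ?thesis by eventually_elim simp
  qed
  then have "\<forall>\<^sub>F l in germ_filter s. \<forall>i\<in>{..<n}. \<bar>b l $ i\<bar> \<le> r"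
    by (intro eventually_ball_finite) auto
  moreover have "\<forall>\<^sub>F l in germ_filter s. b l \<in> carrier_vec n"
    using b by (simp add: curve_germ_def)
  ultimately show ?thesis
    by eventually_elim (use \<open>0 < r\<close> in \<open>auto simp: vec_cball_def sup_norm_le_iff\<close>)
qed

section \<open>Nondegenerate networks act bijectively on germs\<close>

lemma isCont_admissible:
  assumes W: "W \<in> carrier_mat n n" and i: "i < n" and "C_times (Suc 0) g" "C_times (Suc 0) h"
  shows "isCont (\<lambda>l. admissible g h W x l $ i) l"
proof -
  have g: "isCont g p" and h: "isCont h q" for p q
    by (intro differentiable_imp_continuous_within C1_differentiable assms(3,4))+
  then show ?thesis
    unfolding admissible_index[OF W i]
    by (intro continuous_intros isCont_o2[OF _ g] isCont_o2[OF _ h])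
qed

context diffusive_system
begin

lemma germ_eq_if_admissible_eq:
  assumes W: "W \<in> carrier_mat n n" and det: "det (jacobian_matrix g h W) \<noteq> 0"
    and x: "curve_germ n s x" and y: "curve_germ n s y"
    and eq: "\<forall>\<^sub>F l in germ_filter s. admissible g h W (x l) l = admissible g h W (y l) l"
  shows "germ_eq s x y"
proof -
  obtain r \<rho> K where r: "0 < r" and expansive: "\<And>l x y.
      \<bar>l\<bar> \<le> r \<Longrightarrow> x \<in> vec_cball n r \<Longrightarrow> y \<in> vec_cball n r \<Longrightarrow>
      sup_norm (x - y) \<le> K * sup_norm (admissible g h W x l - admissible g h W y l)"
    by (rule admissible_local_inverse[OF W det]) blast
  show ?thesis
    unfolding germ_eq_iff_eventually
    using eq eventually_germ_filter_abs_le[OF r] curve_germ_eventually_in_vec_cball[OF x r]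
      curve_germ_eventually_in_vec_cball[OF y r]
  proof eventually_elim
    case (elim l)
    then have xy: "x l \<in> carrier_vec n" "y l \<in> carrier_vec n"
      by (simp_all add: vec_cball_def)
    have "admissible g h W (x l) l - admissible g h W (y l) l = 0\<^sub>v n"
      using elim(1) admissible_carrier[OF W] by (simp add: diff_eq_0_vec_iff)
    then have "sup_norm (x l - y l) \<le> 0"
      using expansive[OF elim(2-4)] by simp
    then have "x l - y l = 0\<^sub>v n"
      using xy by (intro eq_0_vec_if_sup_norm_le_0) auto
    then show "x l = y l"
      using xy by (simp add: diff_eq_0_vec_iff)
  qed
qed

lemma equilibrium_branch_trivial:
  assumes W: "W \<in> carrier_mat n n" and det: "det (jacobian_matrix g h W) \<noteq> 0"
    and "equilibrium_branch n (admissible g h W) s b"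
  shows "germ_eq s b (\<lambda>l. 0\<^sub>v n)"
  using assms(3) germ_eq_if_admissible_eq[OF W det _ curve_germ_zero]
  by (simp add: equilibrium_branch_iff_curve_germ admissible_0[OF W])

text \<open>The solution at \<open>l\<close> is compared with the constant curve \<open>x l0\<close>.\<close>

lemma continuous_if_expansive_solution:
  assumes W: "W \<in> carrier_mat n n"
    and x0: "x l0 \<in> carrier_vec n" "admissible g h W (x l0) l0 = y l0"
    and y: "\<And>i. i < n \<Longrightarrow> continuous (at l0 within S) (\<lambda>l. y l $ i)"
    and close: "\<forall>\<^sub>F l in at l0 within S. x l \<in> carrier_vec n \<and> y l \<in> carrier_vec n \<and>
      sup_norm (x l - x l0) \<le> K * sup_norm (y l - admissible g h W (x l0) l)"
    and i: "i < n"
  shows "continuous (at l0 within S) (\<lambda>l. x l $ i)"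
proof -
  define gap where "gap l = y l - admissible g h W (x l0) l" for l
  have "((\<lambda>l. sup_norm (gap l)) \<longlongrightarrow> 0) (at l0 within S)"
  proof (rule tendsto_sup_norm_zero)
    show "\<forall>\<^sub>F l in at l0 within S. gap l \<in> carrier_vec n"
      using close by eventually_elim (simp add: gap_def admissible_carrier[OF W])
    fix j assume j: "j < n"
    have "((\<lambda>l. y l $ j - admissible g h W (x l0) l $ j) \<longlongrightarrow>
        y l0 $ j - admissible g h W (x l0) l0 $ j) (at l0 within S)"
      using y[OF j] isCont_admissible[OF W j C1_g C1_h]
      by (intro tendsto_diff) (auto simp: continuous_within intro: tendsto_within_subset)
    moreover have "gap l $ j = y l $ j - admissible g h W (x l0) l $ j" for l
      using j carrier_vecD[OF admissible_carrier[OF W]] by (simp add: gap_def)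
    ultimately show "((\<lambda>l. gap l $ j) \<longlongrightarrow> 0) (at l0 within S)"
      using x0(2) by simp
  qed
  then have "((\<lambda>l. K * sup_norm (gap l)) \<longlongrightarrow> 0) (at l0 within S)"
    by (rule tendsto_mult_right_zero)
  moreover have "\<forall>\<^sub>F l in at l0 within S. norm (x l $ i - x l0 $ i) \<le> K * sup_norm (gap l)"
    using close
  proof eventually_elim
    case (elim l)
    then have "\<bar>(x l - x l0) $ i\<bar> \<le> sup_norm (x l - x l0)"
      using x0(1) i by (intro abs_index_le_sup_norm) auto
    with elim show ?case
      using x0(1) i by (simp add: gap_def)
  qed
  ultimately have "((\<lambda>l. x l $ i - x l0 $ i) \<longlongrightarrow> 0) (at l0 within S)"
    by (rule Lim_null_comparison[rotated])
  then show ?thesis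
    using Lim_null by (auto simp: continuous_within)
qed

lemma admissible_pointwise_solution:
  assumes W: "W \<in> carrier_mat n n" and det: "det (jacobian_matrix g h W) \<noteq> 0"
    and y: "curve_germ n s y"
  obtains x K where "\<And>l. x l \<in> carrier_vec n" "x 0 = 0\<^sub>v n"
    and "\<forall>\<^sub>F l in germ_filter s. admissible g h W (x l) l = y l \<and>
      (\<forall>l0. sup_norm (x l - x l0) \<le> K * sup_norm (y l - admissible g h W (x l0) l))"
proof -
  let ?F = "admissible g h W"
  obtain r \<rho> K where r: "0 < r" and \<rho>: "0 < \<rho>"
    and expansive: "\<And>l x y. \<bar>l\<bar> \<le> r \<Longrightarrow> x \<in> vec_cball n r \<Longrightarrow> y \<in> vec_cball n r \<Longrightarrow>
      sup_norm (x - y) \<le> K * sup_norm (?F x l - ?F y l)"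
    and solvable: "\<And>l y. \<bar>l\<bar> \<le> r \<Longrightarrow> y \<in> vec_cball n \<rho> \<Longrightarrow> \<exists>x \<in> vec_cball n r. ?F x l = y"
    by (rule admissible_local_inverse[OF W det]) blast
  define small where "small l \<longleftrightarrow> \<bar>l\<bar> \<le> r \<and> y l \<in> vec_cball n \<rho>" for l
  have small: "\<forall>\<^sub>F l in germ_filter s. small l"
    unfolding small_def using eventually_germ_filter_abs_le[OF r]
      curve_germ_eventually_in_vec_cball[OF y \<rho>] by (rule eventually_conj)
  have zero: "0\<^sub>v n \<in> vec_cball n r" using r by (simp add: vec_cball_def)
  have "\<exists>v \<in> vec_cball n r. small l \<longrightarrow> ?F v l = y l" for l
    using solvable[of l "y l"] zero by (auto simp: small_def)
  then obtain x where x: "\<And>l. x l \<in> vec_cball n r" and Fx: "\<And>l. small l \<Longrightarrow> ?F (x l) l = y l"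
    by metis
  have x_carrier: "x l \<in> carrier_vec n" for l
    using x[of l] by (simp add: vec_cball_def)
  have close: "sup_norm (x l - v) \<le> K * sup_norm (y l - ?F v l)"
    if "small l" "v \<in> vec_cball n r" for l v
    using expansive[of l "x l" v] x Fx that by (simp add: small_def)
  have "sup_norm (x 0 - 0\<^sub>v n) \<le> K * sup_norm (y 0 - ?F (0\<^sub>v n) 0)"
    using close[OF eventually_germ_filter_at_0[OF small] zero] .
  then have x_0: "x 0 = 0\<^sub>v n"
    using y x_carrier[of 0] eq_0_vec_if_sup_norm_le_0[of "x 0" n]
    by (simp add: curve_germ_def admissible_0[OF W])
  have "\<forall>\<^sub>F l in germ_filter s. ?F (x l) l = y l \<and>
      (\<forall>l0. sup_norm (x l - x l0) \<le> K * sup_norm (y l - ?F (x l0) l))"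
    using small by eventually_elim (use Fx close x in blast)
  with x_carrier x_0 show ?thesis by (rule that)
qed

lemma admissible_solvable_along_germ:
  assumes W: "W \<in> carrier_mat n n" and det: "det (jacobian_matrix g h W) \<noteq> 0"
    and y: "curve_germ n s y"
  obtains x where "curve_germ n s x" "\<And>l. x l \<in> carrier_vec n"
    and "\<forall>\<^sub>F l in germ_filter s. admissible g h W (x l) l = y l"
proof -
  let ?F = "admissible g h W"
  obtain x K where x: "\<And>l. x l \<in> carrier_vec n" "x 0 = 0\<^sub>v n"
    and sol: "\<forall>\<^sub>F l in germ_filter s. ?F (x l) l = y l \<and>
      (\<forall>l0. sup_norm (x l - x l0) \<le> K * sup_norm (y l - ?F (x l0) l))"
    by (rule admissible_pointwise_solution[OF W det y]) (rule that)
  have "\<forall>\<^sub>F l0 in germ_filter s. \<forall>i\<in>{..<n}. continuous (at l0 within branch_side s) (\<lambda>l. y l $ i)"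
    using y by (intro eventually_ball_finite) (auto simp: curve_germ_def)
  moreover have y_carrier: "\<forall>\<^sub>F l in germ_filter s. y l \<in> carrier_vec n"
    using y by (simp add: curve_germ_def)
  ultimately have "\<forall>\<^sub>F l0 in germ_filter s. continuous (at l0 within branch_side s) (\<lambda>l. x l $ i)"
    if "i < n" for i
    using sol eventually_germ_filter_within[OF eventually_conj[OF y_carrier sol]]
  proof eventually_elim
    case (elim l0)
    have "\<forall>\<^sub>F l in at l0 within branch_side s. x l \<in> carrier_vec n \<and> y l \<in> carrier_vec n \<and>
        sup_norm (x l - x l0) \<le> K * sup_norm (y l - ?F (x l0) l)"
      using elim(4) x(1) by (auto elim: eventually_mono)
    with elim show ?case
      using continuous_if_expansive_solution[of W n x l0 y "branch_side s" K i] W x(1) that by simp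
  qed
  then have "curve_germ n s x"
    using x by (simp add: curve_germ_def)
  moreover have "\<forall>\<^sub>F l in germ_filter s. ?F (x l) l = y l"
    using sol by eventually_elim blast
  ultimately show ?thesis
    using x(1) by (intro that)
qed

lemma curve_germ_internal_dynamics:
  assumes "curve_germ 1 s (\<lambda>l. vec1 (c l))"
  shows "curve_germ 1 s (\<lambda>l. vec1 (g (c l, l)))"
proof -
  have "\<forall>\<^sub>F l in germ_filter s. continuous (at l within branch_side s) (\<lambda>l. vec1 (c l) $ 0)"
    using assms by (simp add: curve_germ_def)
  then have "\<forall>\<^sub>F l in germ_filter s. continuous (at l within branch_side s) (\<lambda>l. g (c l, l))"
  proof eventually_elim
    case (elim l)
    have "isCont g (c l, l)"
      by (intro differentiable_imp_continuous_within C1_differentiable C1_g)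
    with elim show ?case
      using continuous_within_compose3[where g = g and f = "\<lambda>l. (c l, l)"]
      by (simp add: continuous_intros)
  qed
  then show ?thesis
    using assms g_0 by (simp add: curve_germ_def zero_vec_1 vec1_eq_iff del: One_nat_def)
qed

text \<open>The internal dynamics is the vector field of an isolated cell, whose Jacobian is \<open>g_deriv g\<close>.\<close>

lemma germ_eq_if_internal_dynamics_eq:
  assumes "g_deriv g \<noteq> 0"
    and a: "curve_germ 1 s (\<lambda>l. vec1 (a l))" and b: "curve_germ 1 s (\<lambda>l. vec1 (b l))"
    and eq: "\<forall>\<^sub>F l in germ_filter s. g (a l, l) = g (b l, l)"
  shows "germ_eq s a b"
proof -
  let ?W = "0\<^sub>m 1 1 :: real mat"
  have W: "?W \<in> carrier_mat 1 1" by simp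
  have "laplacian ?W = 0\<^sub>m 1 1"
    by (intro eq_matI) (auto simp: laplacian_def mat_diag_def valency_def)
  then have "det (jacobian_matrix g h ?W) = g_deriv g"
    using det_single[OF jacobian_matrix_carrier[OF W]] by (simp add: jacobian_matrix_def)
  moreover have "admissible g h ?W (vec1 x) l = vec1 (g (x, l))" for x l
    by (intro eq_vecI) (auto simp: admissible_def)
  ultimately show ?thesis
    using germ_eq_if_admissible_eq[OF W _ a b] assms(1) eq
    by (simp add: vec1_eq_iff germ_eq_vec1_iff del: One_nat_def)
qed

end

section \<open>Feedforward coalescence\<close>

context
  fixes W1 W2 :: "real mat" and m1 m2 :: nat
  assumes W1: "W1 \<in> carrier_mat (m1 + 1) (m1 + 1)" and W2: "W2 \<in> carrier_mat (1 + m2) (1 + m2)"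
begin

lemma coalescence_row_fst:
  assumes feedforward: "\<And>j. 0 < j \<Longrightarrow> j < 1 + m2 \<Longrightarrow> W2 $$ (0, j) = 0"
    and i: "i < m1 + 1" and f: "f i = 0"
  shows "(\<Sum>j<m1 + (1 + m2). coalescence W1 W2 $$ (i, j) * f j) = (\<Sum>j<m1 + 1. W1 $$ (i, j) * f j)"
proof (rule sum.mono_neutral_cong_right)
  show "\<forall>j\<in>{..<m1 + (1 + m2)} - {..<m1 + 1}. coalescence W1 W2 $$ (i, j) * f j = 0"
    using W1 W2 i feedforward by (auto simp: coalescence_def Let_def)
  show "coalescence W1 W2 $$ (i, j) * f j = W1 $$ (i, j) * f j" if "j \<in> {..<m1 + 1}" for j
    using that W1 W2 i f by (auto simp: coalescence_def Let_def)
qed auto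

lemma coalescence_row_snd:
  assumes k: "0 < k" "k < 1 + m2"
  shows "(\<Sum>j<m1 + (1 + m2). coalescence W1 W2 $$ (m1 + k, j) * f j)
    = (\<Sum>j<1 + m2. W2 $$ (k, j) * f (m1 + j))"
proof -
  have "(\<Sum>j<m1 + (1 + m2). coalescence W1 W2 $$ (m1 + k, j) * f j)
      = (\<Sum>j\<in>{m1..<m1 + (1 + m2)}. W2 $$ (k, j - m1) * f j)"
  proof (rule sum.mono_neutral_cong_right)
    show "\<forall>j\<in>{..<m1 + (1 + m2)} - {m1..<m1 + (1 + m2)}. coalescence W1 W2 $$ (m1 + k, j) * f j = 0"
      using W1 W2 k by (auto simp: coalescence_def Let_def)
    show "coalescence W1 W2 $$ (m1 + k, j) * f j = W2 $$ (k, j - m1) * f j"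
      if "j \<in> {m1..<m1 + (1 + m2)}" for j
      using that W1 W2 k by (auto simp: coalescence_def Let_def)
  qed auto
  also have "\<dots> = (\<Sum>j<1 + m2. W2 $$ (k, j) * f (m1 + j))"
    using sum.shift_bounds_nat_ivl[of "\<lambda>j. W2 $$ (k, j - m1) * f j" 0 m1 "1 + m2"]
    by (simp add: lessThan_atLeast0 add.commute)
  finally show ?thesis .
qed

lemma coalescence_carrier:
  "coalescence W1 W2 \<in> carrier_mat (m1 + (1 + m2)) (m1 + (1 + m2))"
  using W1 W2 by (auto simp: coalescence_def Let_def)

lemma admissible_coalescence_index_fst:
  assumes feedforward: "\<And>j. 0 < j \<Longrightarrow> j < 1 + m2 \<Longrightarrow> W2 $$ (0, j) = 0"
    and diffusive: "diffusive h" and x1: "x1 \<in> carrier_vec m1" and x2: "x2 \<in> carrier_vec m2"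
    and i: "i < m1 + 1"
  shows "admissible g h (coalescence W1 W2) (x1 @\<^sub>v vec1 c @\<^sub>v x2) l $ i =
    admissible g h W1 (x1 @\<^sub>v vec1 c) l $ i"
proof -
  let ?x = "x1 @\<^sub>v vec1 c @\<^sub>v x2"
  have "?x $ j = (x1 @\<^sub>v vec1 c) $ j" if "j < m1 + 1" for j
    using that x1 x2 by auto
  then show ?thesis
    using coalescence_row_fst[OF feedforward i, of "\<lambda>j. h (?x $ i, ?x $ j, l)"]
      diffusive i
    by (simp add: admissible_index[OF coalescence_carrier] admissible_index[OF W1]
        diffusive_def del: index_append_vec One_nat_def)
qed

lemma admissible_coalescence_index_snd:
  assumes x1: "x1 \<in> carrier_vec m1" and x2: "x2 \<in> carrier_vec m2" and k: "0 < k" "k < 1 + m2"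
  shows "admissible g h (coalescence W1 W2) (x1 @\<^sub>v vec1 c @\<^sub>v x2) l $ (m1 + k) =
    admissible g h W2 (vec1 c @\<^sub>v x2) l $ k"
proof -
  let ?x = "x1 @\<^sub>v vec1 c @\<^sub>v x2"
  have "?x $ (m1 + j) = (vec1 c @\<^sub>v x2) $ j" if "j < 1 + m2" for j
    using that x1 x2 by auto
  then show ?thesis
    using coalescence_row_snd[OF k, of "\<lambda>j. h (?x $ (m1 + k), ?x $ j, l)"] k
    by (simp add: admissible_index[OF coalescence_carrier] admissible_index[OF W2]
        del: index_append_vec One_nat_def)
qed

lemma admissible_coalescence:
  assumes feedforward: "\<And>j. 0 < j \<Longrightarrow> j < 1 + m2 \<Longrightarrow> W2 $$ (0, j) = 0"
    and diffusive: "diffusive h" and x1: "x1 \<in> carrier_vec m1" and x2: "x2 \<in> carrier_vec m2"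
  shows "admissible g h (coalescence W1 W2) (x1 @\<^sub>v vec1 c @\<^sub>v x2) l =
    admissible g h W1 (x1 @\<^sub>v vec1 c) l @\<^sub>v vec_last (admissible g h W2 (vec1 c @\<^sub>v x2) l) m2"
    (is "?F = ?F1 @\<^sub>v vec_last ?F2 m2")
proof (rule eq_vecI)
  have dim: "dim_vec ?F = m1 + (1 + m2)" "dim_vec ?F1 = m1 + 1" "dim_vec ?F2 = 1 + m2"
    by (rule carrier_vecD admissible_carrier coalescence_carrier W1 W2)+
  show "dim_vec ?F = dim_vec (?F1 @\<^sub>v vec_last ?F2 m2)"
    by (simp add: dim del: One_nat_def)
  fix i assume i: "i < dim_vec (?F1 @\<^sub>v vec_last ?F2 m2)"
  show "?F $ i = (?F1 @\<^sub>v vec_last ?F2 m2) $ i"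
  proof (cases "i < m1 + 1")
    case True
    then show ?thesis
      using admissible_coalescence_index_fst[OF feedforward diffusive x1 x2 True]
      by (simp add: dim del: One_nat_def)
  next
    case False
    define k where "k = i - m1"
    have k: "0 < k" "k < 1 + m2" "i = m1 + k"
      using False i by (auto simp: k_def dim simp del: One_nat_def)
    then show ?thesis
      using False admissible_coalescence_index_snd[OF x1 x2 k(1,2)]
      by (simp add: dim vec_last_def del: One_nat_def)
  qed
qed

end

locale feedforward_system = diffusive_system +
  fixes W1 W2 :: "real mat" and m1 m2 :: nat
  assumes feedforward: "feedforward_coalescence (m1 + 1) (1 + m2) W1 W2"
begin

lemma W1: "W1 \<in> carrier_mat (m1 + 1) (m1 + 1)" and W2: "W2 \<in> carrier_mat (1 + m2) (1 + m2)"
  and no_feedback: "0 < j \<Longrightarrow> j < 1 + m2 \<Longrightarrow> W2 $$ (0, j) = 0"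
  using feedforward by (auto simp: feedforward_coalescence_def network_def)

abbreviation N :: "real mat" where
  "N \<equiv> coalescence W1 W2"

lemma admissible_snd_0: "admissible g h W2 (vec1 c @\<^sub>v x) l $ 0 = g (c, l)"
proof -
  have "W2 $$ (0, j) * h (c, (vec1 c @\<^sub>v x) $ j, l) = 0" if "j < 1 + m2" for j
    using no_feedback[of j] that diffusive by (cases "j = 0") (auto simp: diffusive_def)
  then have "(\<Sum>j<1 + m2. W2 $$ (0, j) * h (c, (vec1 c @\<^sub>v x) $ j, l)) = 0"
    by (intro sum.neutral) blast
  then show ?thesis
    by (subst admissible_index[OF W2]) auto
qed

lemma admissible_snd:
  "admissible g h W2 (vec1 c @\<^sub>v x) l =
    vec1 (g (c, l)) @\<^sub>v vec_last (admissible g h W2 (vec1 c @\<^sub>v x) l) m2"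
  using vec1_append_vec_last[OF admissible_carrier[OF W2]] by (metis admissible_snd_0)

definition response_branch :: "side \<Rightarrow> (real \<Rightarrow> real) \<Rightarrow> (real \<Rightarrow> real vec) \<Rightarrow> bool" where
  "response_branch s c b \<longleftrightarrow> curve_germ m2 s b \<and>
    (\<forall>\<^sub>F l in germ_filter s. vec_last (admissible g h W2 (vec1 (c l) @\<^sub>v b l) l) m2 = 0\<^sub>v m2)"

lemma equilibrium_branch_coalescence_iff:
  assumes b1: "b1 \<in> UNIV \<rightarrow> carrier_vec m1" and b2: "b2 \<in> UNIV \<rightarrow> carrier_vec m2"
  shows "equilibrium_branch (m1 + (1 + m2)) (admissible g h N) s
      (\<lambda>l. b1 l @\<^sub>v vec1 (c l) @\<^sub>v b2 l) \<longleftrightarrow>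
    equilibrium_branch (m1 + 1) (admissible g h W1) s (\<lambda>l. b1 l @\<^sub>v vec1 (c l)) \<and>
    response_branch s c b2"
proof -
  have c1: "b1 l \<in> carrier_vec m1" and c2: "b2 l \<in> carrier_vec m2" for l
    using b1 b2 by auto
  have "admissible g h N (b1 l @\<^sub>v vec1 (c l) @\<^sub>v b2 l) l = 0\<^sub>v (m1 + (1 + m2)) \<longleftrightarrow>
      admissible g h W1 (b1 l @\<^sub>v vec1 (c l)) l = 0\<^sub>v (m1 + 1) \<and>
      vec_last (admissible g h W2 (vec1 (c l) @\<^sub>v b2 l) l) m2 = 0\<^sub>v m2" for l
    using append_eq_zero_vec_iff[OF admissible_carrier[OF W1]]
      admissible_coalescence[OF W1 W2 no_feedback diffusive c1 c2]
    by (simp add: add.assoc del: One_nat_def)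
  moreover have "curve_germ (m1 + (1 + m2)) s (\<lambda>l. b1 l @\<^sub>v vec1 (c l) @\<^sub>v b2 l) \<longleftrightarrow>
      curve_germ (m1 + 1) s (\<lambda>l. b1 l @\<^sub>v vec1 (c l)) \<and> curve_germ m2 s b2"
    using c1 c2 by (simp add: curve_germ_append_iff del: One_nat_def)
  ultimately show ?thesis
    by (auto simp: equilibrium_branch_iff_curve_germ response_branch_def eventually_conj_iff
        simp del: One_nat_def)
qed

lemma equilibrium_branch_snd_iff:
  assumes b2: "b2 \<in> UNIV \<rightarrow> carrier_vec m2"
  shows "equilibrium_branch (1 + m2) (admissible g h W2) s (\<lambda>l. vec1 (c l) @\<^sub>v b2 l) \<longleftrightarrow>
    curve_germ 1 s (\<lambda>l. vec1 (c l)) \<and> (\<forall>\<^sub>F l in germ_filter s. g (c l, l) = 0) \<and>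
    response_branch s c b2"
proof -
  have c2: "b2 l \<in> carrier_vec m2" for l
    using b2 by auto
  have "admissible g h W2 (vec1 (c l) @\<^sub>v b2 l) l = 0\<^sub>v (1 + m2) \<longleftrightarrow>
      g (c l, l) = 0 \<and> vec_last (admissible g h W2 (vec1 (c l) @\<^sub>v b2 l) l) m2 = 0\<^sub>v m2" for l
    by (subst admissible_snd, subst append_eq_zero_vec_iff)
      (simp_all add: zero_vec_1 vec1_eq_iff del: One_nat_def)
  moreover have "curve_germ (1 + m2) s (\<lambda>l. vec1 (c l) @\<^sub>v b2 l) \<longleftrightarrow>
      curve_germ 1 s (\<lambda>l. vec1 (c l)) \<and> curve_germ m2 s b2"
    using c2 by (intro curve_germ_append_iff) auto
  ultimately show ?thesis
    by (auto simp: equilibrium_branch_iff_curve_germ response_branch_def eventually_conj_iff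
        simp del: One_nat_def)
qed

lemma equilibrium_branch_fst_imp_curve_germ:
  assumes b1: "b1 \<in> UNIV \<rightarrow> carrier_vec m1"
    and "equilibrium_branch (m1 + 1) (admissible g h W1) s (\<lambda>l. b1 l @\<^sub>v vec1 (c l))"
  shows "curve_germ 1 s (\<lambda>l. vec1 (c l))"
  using assms curve_germ_append_iff[of b1 m1 "\<lambda>l. vec1 (c l)" 1 s]
  by (auto simp: equilibrium_branch_iff_curve_germ simp del: One_nat_def)

lemma response_branch_unique:
  assumes det: "det (jacobian_matrix g h W2) \<noteq> 0"
    and c: "curve_germ 1 s (\<lambda>l. vec1 (c l))"
    and carrier: "b \<in> UNIV \<rightarrow> carrier_vec m2" "b' \<in> UNIV \<rightarrow> carrier_vec m2"
    and response: "response_branch s c b" "response_branch s c b'"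
  shows "germ_eq s b b'"
proof -
  let ?x = "\<lambda>b l. vec1 (c l) @\<^sub>v b l"
  have "curve_germ (1 + m2) s (?x b)" "curve_germ (1 + m2) s (?x b')"
    using c response carrier
    by (auto simp: curve_germ_append_iff response_branch_def Pi_iff simp del: One_nat_def)
  moreover have
    "\<forall>\<^sub>F l in germ_filter s. admissible g h W2 (?x b l) l = admissible g h W2 (?x b' l) l"
    using response[unfolded response_branch_def, THEN conjunct2]
    by eventually_elim (metis admissible_snd)
  ultimately have "germ_eq s (?x b) (?x b')"
    by (rule germ_eq_if_admissible_eq[OF W2 det])
  then show ?thesis
    by (auto simp: germ_eq_def append_vec_eq[of _ 1] simp del: One_nat_def)
qed

lemma response_branch_exists:
  assumes det: "det (jacobian_matrix g h W2) \<noteq> 0"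
    and c: "curve_germ 1 s (\<lambda>l. vec1 (c l))"
  obtains b where "b \<in> UNIV \<rightarrow> carrier_vec m2" "response_branch s c b"
proof -
  define y where "y l = vec1 (g (c l, l)) @\<^sub>v 0\<^sub>v m2" for l
  have "curve_germ (1 + m2) s y"
    unfolding y_def using curve_germ_internal_dynamics[OF c] curve_germ_zero
    by (simp add: curve_germ_append_iff del: One_nat_def)
  then obtain x where x: "curve_germ (1 + m2) s x" "\<And>l. x l \<in> carrier_vec (1 + m2)"
      and Fx: "\<forall>\<^sub>F l in germ_filter s. admissible g h W2 (x l) l = y l"
    by (rule admissible_solvable_along_germ[OF W2 det]) (rule that)
  define c' b where "c' l = x l $ 0" and "b l = vec_last (x l) m2" for l
  have x_eq: "x = (\<lambda>l. vec1 (c' l) @\<^sub>v b l)"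
    using vec1_append_vec_last[OF x(2)] by (simp add: c'_def b_def del: One_nat_def)
  have curve: "curve_germ 1 s (\<lambda>l. vec1 (c' l))" "curve_germ m2 s b"
    using x(1) curve_germ_append_iff[of "\<lambda>l. vec1 (c' l)" 1 b m2 s] unfolding x_eq
    by (simp_all add: b_def)
  have F: "\<forall>\<^sub>F l in germ_filter s. g (c' l, l) = g (c l, l) \<and>
      vec_last (admissible g h W2 (vec1 (c' l) @\<^sub>v b l) l) m2 = 0\<^sub>v m2"
    using Fx
  proof eventually_elim
    case (elim l)
    then show ?case
      unfolding x_eq y_def
      by (subst (asm) admissible_snd) (simp add: append_vec_eq[of _ 1] vec1_eq_iff del: One_nat_def)
  qed
  have "g_deriv g \<noteq> 0"
    using g_deriv_neq_0_if_nonsingular[OF W2 _ det] by simp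
  then have "germ_eq s c' c"
    using F by (intro germ_eq_if_internal_dynamics_eq curve(1) c) (auto elim: eventually_mono)
  then have "\<forall>\<^sub>F l in germ_filter s.
      vec_last (admissible g h W2 (vec1 (c l) @\<^sub>v b l) l) m2 = 0\<^sub>v m2"
    using F unfolding germ_eq_iff_eventually by eventually_elim simp
  then show ?thesis
    using curve(2) by (intro that[of b]) (auto simp: response_branch_def b_def)
qed

section \<open>Bifurcation branches of feedforward coalescence networks\<close>

lemma germ_eq_zero_coalescence_iff:
  assumes "b1 \<in> UNIV \<rightarrow> carrier_vec m1"
  shows "germ_eq s (\<lambda>l. b1 l @\<^sub>v vec1 (c l) @\<^sub>v b2 l) (\<lambda>l. 0\<^sub>v (m1 + (1 + m2))) \<longleftrightarrow>
    germ_eq s b1 (\<lambda>l. 0\<^sub>v m1) \<and> germ_eq s c (\<lambda>l. 0) \<and> germ_eq s b2 (\<lambda>l. 0\<^sub>v m2)"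
  using assms
  by (simp add: germ_eq_zero_append_iff Pi_iff zero_vec_1 germ_eq_vec1_iff del: One_nat_def)

lemma germ_eq_zero_fst_iff:
  assumes "b1 \<in> UNIV \<rightarrow> carrier_vec m1"
  shows "germ_eq s (\<lambda>l. b1 l @\<^sub>v vec1 (c l)) (\<lambda>l. 0\<^sub>v (m1 + 1)) \<longleftrightarrow>
    germ_eq s b1 (\<lambda>l. 0\<^sub>v m1) \<and> germ_eq s c (\<lambda>l. 0)"
  using assms
  by (simp add: germ_eq_zero_append_iff Pi_iff zero_vec_1 germ_eq_vec1_iff del: One_nat_def)

lemma germ_eq_zero_snd_iff:
  "germ_eq s (\<lambda>l. vec1 (c l) @\<^sub>v b2 l) (\<lambda>l. 0\<^sub>v (1 + m2)) \<longleftrightarrow>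
    germ_eq s c (\<lambda>l. 0) \<and> germ_eq s b2 (\<lambda>l. 0\<^sub>v m2)"
  by (simp add: germ_eq_zero_append_iff zero_vec_1 germ_eq_vec1_iff del: One_nat_def)

lemma internal_dynamics_zero_if_germ_eq_zero:
  "germ_eq s c (\<lambda>l. 0) \<Longrightarrow> \<forall>\<^sub>F l in germ_filter s. g (c l, l) = 0"
  by (auto simp: germ_eq_iff_eventually g_0 elim!: eventually_mono)

lemma bifurcation_branch_fst_extends:
  assumes det: "det (jacobian_matrix g h W2) \<noteq> 0" and b1: "b1 \<in> UNIV \<rightarrow> carrier_vec m1"
    and bif: "bifurcation_branch (m1 + 1) (admissible g h W1) s (\<lambda>l. b1 l @\<^sub>v vec1 (c l))"
  shows "\<exists>b2 \<in> UNIV \<rightarrow> carrier_vec m2.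
    bifurcation_branch (m1 + (1 + m2)) (admissible g h N) s (\<lambda>l. b1 l @\<^sub>v vec1 (c l) @\<^sub>v b2 l) \<and>
    (\<forall>b2' \<in> UNIV \<rightarrow> carrier_vec m2.
      bifurcation_branch (m1 + (1 + m2)) (admissible g h N) s
        (\<lambda>l. b1 l @\<^sub>v vec1 (c l) @\<^sub>v b2' l) \<longrightarrow> germ_eq s b2' b2)"
proof -
  have eq1: "equilibrium_branch (m1 + 1) (admissible g h W1) s (\<lambda>l. b1 l @\<^sub>v vec1 (c l))"
    using bif by (simp add: bifurcation_branch_def)
  note c = equilibrium_branch_fst_imp_curve_germ[OF b1 eq1]
  obtain b2 where b2: "b2 \<in> UNIV \<rightarrow> carrier_vec m2" "response_branch s c b2"
    using response_branch_exists[OF det c] by blast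
  have "bifurcation_branch (m1 + (1 + m2)) (admissible g h N) s (\<lambda>l. b1 l @\<^sub>v vec1 (c l) @\<^sub>v b2 l)"
    using bif b2 unfolding bifurcation_branch_def equilibrium_branch_coalescence_iff[OF b1 b2(1)]
      germ_eq_zero_coalescence_iff[OF b1] germ_eq_zero_fst_iff[OF b1] by blast
  moreover have "germ_eq s b2' b2" if b2': "b2' \<in> UNIV \<rightarrow> carrier_vec m2"
    and "bifurcation_branch (m1 + (1 + m2)) (admissible g h N) s
      (\<lambda>l. b1 l @\<^sub>v vec1 (c l) @\<^sub>v b2' l)" for b2'
  proof -
    have "response_branch s c b2'"
      using that(2) unfolding bifurcation_branch_def equilibrium_branch_coalescence_iff[OF b1 b2']
      by blast
    then show ?thesis
      using b2(2) by (rule response_branch_unique[OF det c b2' b2(1)])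
  qed
  ultimately show ?thesis
    using b2(1) by blast
qed

lemma bifurcation_branch_restricts_to_fst:
  assumes det: "det (jacobian_matrix g h W2) \<noteq> 0"
    and b1: "b1 \<in> UNIV \<rightarrow> carrier_vec m1" and b2: "b2 \<in> UNIV \<rightarrow> carrier_vec m2"
    and bif: "bifurcation_branch (m1 + (1 + m2)) (admissible g h N) s
      (\<lambda>l. b1 l @\<^sub>v vec1 (c l) @\<^sub>v b2 l)"
  shows "bifurcation_branch (m1 + 1) (admissible g h W1) s (\<lambda>l. b1 l @\<^sub>v vec1 (c l))"
proof -
  have eq1: "equilibrium_branch (m1 + 1) (admissible g h W1) s (\<lambda>l. b1 l @\<^sub>v vec1 (c l))"
    and response: "response_branch s c b2"
    using bif
    unfolding bifurcation_branch_def equilibrium_branch_coalescence_iff[OF b1 b2] by blast+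
  have "germ_eq s b2 (\<lambda>l. 0\<^sub>v m2)" if c: "germ_eq s c (\<lambda>l. 0)"
  proof -
    have "equilibrium_branch (1 + m2) (admissible g h W2) s (\<lambda>l. vec1 (c l) @\<^sub>v b2 l)"
      unfolding equilibrium_branch_snd_iff[OF b2]
      using equilibrium_branch_fst_imp_curve_germ[OF b1 eq1]
        internal_dynamics_zero_if_germ_eq_zero[OF c] response by blast
    from equilibrium_branch_trivial[OF W2 det this] show ?thesis
      unfolding germ_eq_zero_snd_iff by blast
  qed
  then show ?thesis
    using bif eq1 unfolding bifurcation_branch_def germ_eq_zero_coalescence_iff[OF b1]
      germ_eq_zero_fst_iff[OF b1] by blast
qed

lemma equilibrium_branch_fst_trivial:
  assumes "det (jacobian_matrix g h W1) \<noteq> 0" "b1 \<in> UNIV \<rightarrow> carrier_vec m1"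
    and "equilibrium_branch (m1 + 1) (admissible g h W1) s (\<lambda>l. b1 l @\<^sub>v vec1 (c l))"
  shows "germ_eq s b1 (\<lambda>l. 0\<^sub>v m1)" "germ_eq s c (\<lambda>l. 0)"
  using equilibrium_branch_trivial[OF W1 assms(1,3)] germ_eq_zero_fst_iff[OF assms(2)] by blast+

lemma equilibrium_branch_fst_zero_append:
  assumes c: "curve_germ 1 s (\<lambda>l. vec1 (c l))" and zero: "germ_eq s c (\<lambda>l. 0)"
  shows "equilibrium_branch (m1 + 1) (admissible g h W1) s (\<lambda>l. 0\<^sub>v m1 @\<^sub>v vec1 (c l))"
  unfolding equilibrium_branch_iff_curve_germ
proof
  show "curve_germ (m1 + 1) s (\<lambda>l. 0\<^sub>v m1 @\<^sub>v vec1 (c l))"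
    using c by (simp add: curve_germ_append_iff curve_germ_zero del: One_nat_def)
  have "0\<^sub>v m1 @\<^sub>v vec1 0 = (0\<^sub>v (m1 + 1) :: real vec)"
    by (simp add: append_eq_zero_vec_iff zero_vec_1 del: One_nat_def)
  then show "\<forall>\<^sub>F l in germ_filter s. admissible g h W1 (0\<^sub>v m1 @\<^sub>v vec1 (c l)) l = 0\<^sub>v (m1 + 1)"
    using zero unfolding germ_eq_iff_eventually
    by (auto simp: admissible_0[OF W1] elim!: eventually_mono simp del: One_nat_def)
qed

lemma bifurcation_branch_snd_extends:
  assumes det: "det (jacobian_matrix g h W1) \<noteq> 0" and b2: "b2 \<in> UNIV \<rightarrow> carrier_vec m2"
    and bif: "bifurcation_branch (1 + m2) (admissible g h W2) s (\<lambda>l. vec1 (c l) @\<^sub>v b2 l)"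
  shows "\<exists>b1 \<in> UNIV \<rightarrow> carrier_vec m1.
    bifurcation_branch (m1 + (1 + m2)) (admissible g h N) s (\<lambda>l. b1 l @\<^sub>v vec1 (c l) @\<^sub>v b2 l) \<and>
    (\<forall>b1' \<in> UNIV \<rightarrow> carrier_vec m1.
      bifurcation_branch (m1 + (1 + m2)) (admissible g h N) s
        (\<lambda>l. b1' l @\<^sub>v vec1 (c l) @\<^sub>v b2 l) \<longrightarrow> germ_eq s b1' b1)"
proof (intro bexI conjI ballI impI)
  have c: "curve_germ 1 s (\<lambda>l. vec1 (c l))" and gc: "\<forall>\<^sub>F l in germ_filter s. g (c l, l) = 0"
    and response: "response_branch s c b2"
    using bif unfolding bifurcation_branch_def equilibrium_branch_snd_iff[OF b2] by blast+
  show b1: "(\<lambda>l. 0\<^sub>v m1) \<in> UNIV \<rightarrow> carrier_vec m1"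
    by simp
  have "g_deriv g \<noteq> 0"
    using g_deriv_neq_0_if_nonsingular[OF W1 _ det] by simp
  then have "germ_eq s c (\<lambda>l. 0)"
    using germ_eq_if_internal_dynamics_eq[of s c "\<lambda>l. 0"] c gc curve_germ_zero[of 1 s]
    by (simp add: g_0 zero_vec_1 del: One_nat_def)
  then show "bifurcation_branch (m1 + (1 + m2)) (admissible g h N) s
      (\<lambda>l. 0\<^sub>v m1 @\<^sub>v vec1 (c l) @\<^sub>v b2 l)"
    using bif response equilibrium_branch_fst_zero_append[OF c]
    unfolding bifurcation_branch_def equilibrium_branch_coalescence_iff[OF b1 b2]
      germ_eq_zero_coalescence_iff[OF b1] germ_eq_zero_snd_iff by blast
  fix b1' assume b1': "b1' \<in> UNIV \<rightarrow> carrier_vec m1"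
    and "bifurcation_branch (m1 + (1 + m2)) (admissible g h N) s
      (\<lambda>l. b1' l @\<^sub>v vec1 (c l) @\<^sub>v b2 l)"
  then show "germ_eq s b1' (\<lambda>l. 0\<^sub>v m1)"
    unfolding bifurcation_branch_def equilibrium_branch_coalescence_iff[OF b1' b2]
    using equilibrium_branch_fst_trivial[OF det b1'] by blast
qed

lemma bifurcation_branch_restricts_to_snd:
  assumes det: "det (jacobian_matrix g h W1) \<noteq> 0"
    and b1: "b1 \<in> UNIV \<rightarrow> carrier_vec m1" and b2: "b2 \<in> UNIV \<rightarrow> carrier_vec m2"
    and bif: "bifurcation_branch (m1 + (1 + m2)) (admissible g h N) s
      (\<lambda>l. b1 l @\<^sub>v vec1 (c l) @\<^sub>v b2 l)"
  shows "bifurcation_branch (1 + m2) (admissible g h W2) s (\<lambda>l. vec1 (c l) @\<^sub>v b2 l)"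
proof -
  have eq1: "equilibrium_branch (m1 + 1) (admissible g h W1) s (\<lambda>l. b1 l @\<^sub>v vec1 (c l))"
    and response: "response_branch s c b2"
    using bif
    unfolding bifurcation_branch_def equilibrium_branch_coalescence_iff[OF b1 b2] by blast+
  note trivial = equilibrium_branch_fst_trivial[OF det b1 eq1]
  have "equilibrium_branch (1 + m2) (admissible g h W2) s (\<lambda>l. vec1 (c l) @\<^sub>v b2 l)"
    unfolding equilibrium_branch_snd_iff[OF b2]
    using equilibrium_branch_fst_imp_curve_germ[OF b1 eq1]
      internal_dynamics_zero_if_germ_eq_zero[OF trivial(2)] response by blast
  then show ?thesis
    using bif trivial unfolding bifurcation_branch_def germ_eq_zero_coalescence_iff[OF b1]
      germ_eq_zero_snd_iff by blast
qed

end

theorem proposition3p12: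
  fixes g :: "real \<times> real \<Rightarrow> real"
    and h :: "real \<times> real \<times> real \<Rightarrow> real"
    and W1 W2 :: "real mat"
    and n1 n2 :: nat
    and \<mu> :: complex
  assumes "feedforward_coalescence n1 n2 W1 W2"
    and "smooth g" and "smooth h"
    and "diffusive h"
    and "\<And>l. g (0, l) = 0"
    and "bifurcation_condition g h (coalescence W1 W2) \<mu>"
    and "generic_condition g h (coalescence W1 W2) \<mu>"
  shows
    "(bifurcation_condition g h W1 \<mu> \<and> \<not> bifurcation_condition g h W2 \<mu> \<longrightarrow>
       (\<forall>s. \<forall>b1 \<in> UNIV \<rightarrow> carrier_vec (n1 - 1). \<forall>bc.
          bifurcation_branch n1 (admissible g h W1) s (\<lambda>l. b1 l @\<^sub>v vec1 (bc l)) \<longrightarrow>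
          (\<exists>b2 \<in> UNIV \<rightarrow> carrier_vec (n2 - 1).
             bifurcation_branch (n1 + n2 - 1) (admissible g h (coalescence W1 W2)) s
               (\<lambda>l. b1 l @\<^sub>v vec1 (bc l) @\<^sub>v b2 l) \<and>
             (\<forall>b2' \<in> UNIV \<rightarrow> carrier_vec (n2 - 1).
                bifurcation_branch (n1 + n2 - 1) (admissible g h (coalescence W1 W2)) s
                  (\<lambda>l. b1 l @\<^sub>v vec1 (bc l) @\<^sub>v b2' l) \<longrightarrow> germ_eq s b2' b2))) \<and>
       (\<forall>s. \<forall>b1 \<in> UNIV \<rightarrow> carrier_vec (n1 - 1). \<forall>bc. \<forall>b2 \<in> UNIV \<rightarrow> carrier_vec (n2 - 1).
          bifurcation_branch (n1 + n2 - 1) (admissible g h (coalescence W1 W2)) s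
            (\<lambda>l. b1 l @\<^sub>v vec1 (bc l) @\<^sub>v b2 l) \<longrightarrow>
          bifurcation_branch n1 (admissible g h W1) s (\<lambda>l. b1 l @\<^sub>v vec1 (bc l))))
     \<and>
     (bifurcation_condition g h W2 \<mu> \<and> \<not> bifurcation_condition g h W1 \<mu> \<longrightarrow>
       (\<forall>s. \<forall>bc. \<forall>b2 \<in> UNIV \<rightarrow> carrier_vec (n2 - 1).
          bifurcation_branch n2 (admissible g h W2) s (\<lambda>l. vec1 (bc l) @\<^sub>v b2 l) \<longrightarrow>
          (\<exists>b1 \<in> UNIV \<rightarrow> carrier_vec (n1 - 1).
             bifurcation_branch (n1 + n2 - 1) (admissible g h (coalescence W1 W2)) s
               (\<lambda>l. b1 l @\<^sub>v vec1 (bc l) @\<^sub>v b2 l) \<and>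
             (\<forall>b1' \<in> UNIV \<rightarrow> carrier_vec (n1 - 1).
                bifurcation_branch (n1 + n2 - 1) (admissible g h (coalescence W1 W2)) s
                  (\<lambda>l. b1' l @\<^sub>v vec1 (bc l) @\<^sub>v b2 l) \<longrightarrow> germ_eq s b1' b1))) \<and>
       (\<forall>s. \<forall>b1 \<in> UNIV \<rightarrow> carrier_vec (n1 - 1). \<forall>bc. \<forall>b2 \<in> UNIV \<rightarrow> carrier_vec (n2 - 1).
          bifurcation_branch (n1 + n2 - 1) (admissible g h (coalescence W1 W2)) s
            (\<lambda>l. b1 l @\<^sub>v vec1 (bc l) @\<^sub>v b2 l) \<longrightarrow>
          bifurcation_branch n2 (admissible g h W2) s (\<lambda>l. vec1 (bc l) @\<^sub>v b2 l)))"
proof -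
  obtain m1 m2 where n1: "n1 = m1 + 1" and n2: "n2 = 1 + m2"
    using assms(1) unfolding feedforward_coalescence_def network_def
    by (metis Suc_eq_plus1 Suc_eq_plus1_left gr0_implies_Suc)
  interpret feedforward_system g h W1 W2 m1 m2
    using assms(1-5) unfolding n1 n2 smooth_def by unfold_locales blast+
  have dims: "m1 + 1 - 1 = m1" "1 + m2 - 1 = m2" "m1 + 1 + (1 + m2) - 1 = m1 + (1 + m2)"
    by simp_all
  note nonsingular =
    nonsingular_if_not_bifurcation_condition[OF coalescence_carrier[OF W1 W2] _ assms(6,7)]
  show ?thesis (is "(_ \<longrightarrow> ?A) \<and> (_ \<longrightarrow> ?B)")
  proof (rule conjI; rule impI; elim conjE)
    assume "\<not> bifurcation_condition g h W2 \<mu>"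
    then have "det (jacobian_matrix g h W2) \<noteq> 0"
      using nonsingular[OF _ W2] by simp
    then show ?A
      unfolding n1 n2 dims
      by (intro conjI allI ballI impI)
        (rule bifurcation_branch_fst_extends bifurcation_branch_restricts_to_fst; assumption)+
  next
    assume "\<not> bifurcation_condition g h W1 \<mu>"
    then have "det (jacobian_matrix g h W1) \<noteq> 0"
      using nonsingular[OF _ W1] by simp
    then show ?B
      unfolding n1 n2 dims
      by (intro conjI allI ballI impI)
        (rule bifurcation_branch_snd_extends bifurcation_branch_restricts_to_snd; assumption)+
  qed
qed

end
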